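(* Let $p>1$, let $[X,\mathcal B,m^i,\nu_i]$ ($i=1,2$) be reversible random walk spaces on the same measurable space with $\nu_2\ll\nu_1$, $\mu=\frac{d\nu_2}{d\nu_1}\in L^\infty(X,\nu_1)$, $\mu\ge c>0$ $\nu_1$-a.e., and $\nu_1(X)<\infty$. Assume $\mathcal F_{1,m^1}$ satisfies a $2$-Poincaré inequality with constant $\lambda_2(\mathcal F_{1,m^1})>0$. For $u_0\in L^2(X,\nu_1)$ let $u$ be the strong solution of $u_t-\Delta_1^{m^1}u-\mu\Delta_p^{m^2}u\ni0$, $u(0)=u_0$. Then $$\|u(t)-\overline{u_0}\|_{L^2(X,\nu_1)}\le\big(\|u_0-\overline{u_0}\|_{L^2(X,\nu_1)}-\lambda_2(\mathcal F_{1,m^1})\,t\big)^+\qquad\forall t>0.$$ In particular, $T_{\rm ex}(u_0):=\inf\{T>0: u(t)=\overline{u_0}\ \forall t\ge T\}$ satisfies $T_{\rm ex}(u_0)\le\|u_0-\overline{u_0}\|_{L^2(X,\nu_1)}/\lambda_2(\mathcal F_{1,m^1})$.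
   Context: Random walk space $[X,\mathcal B,m,\nu]$: measurable space with countably generated $\sigma$-algebra, probability measures $m_x$ depending measurably on $x$, $\sigma$-finite invariant measure $\nu$ ($\nu(A)=\int m_x(A)\,d\nu(x)$), reversible if $dm_x(y)d\nu(x)=dm_y(x)d\nu(y)$. $\nabla u(x,y)=u(y)-u(x)$. $\mathcal F_{1,m^1}(u)=\frac12\int_{X\times X}|\nabla u|\,dm^1_x(y)d\nu_1(x)$ ($+\infty$ if infinite). $\overline{u}=\frac1{\nu_1(X)}\int_X u\,d\nu_1$. $\mathcal F_{1,m^1}$ satisfies an $r$-Poincaré inequality ($1\le r<\infty$) if there is $\lambda_r(\mathcal F_{1,m^1})>0$ with $\lambda_r\|u-\overline u\|_{L^r(X,\nu_1)}\le\mathcal F_{1,m^1}(u)$ for all $u\in L^r(X,\nu_1)$. $(u,v)\in\Delta_1^{m}$ iff $(u,-v)\in\partial_{L^2(X,\nu)}\mathcal F_{1,m}(u)$ (convex subdifferential). For $p>1$, $(u,w)\in\Delta_p^{m}$ iff $u,w\in L^2(X,\nu)$, $\nabla u\in L^p(dm_x(y)d\nu(x))$ and $w(x)=\int_X|\nabla u(x,y)|^{p-2}\nabla u(x,y)\,dm_x(y)$. The operator $A=-\Delta_1^{m^1}-\mu\Delta_p^{m^2}$ on $H=L^2(X,\nu_1)$: $(u,v)\in A$ iff $u,v\in H$, $v=v_1-\mu w$ with $(u,-v_1)\in\Delta_1^{m^1}$ (w.r.t. $\nu_1$) and $(u,w)\in\Delta_p^{m^2}$ (w.r.t. $\nu_2$).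 Strong solution: $u\in C([0,\infty);H)\cap W^{1,2}_{\rm loc}(0,\infty;H)$, $u(0)=u_0$, $-u_t(t)\in A(u(t))$ for a.e. $t$. *)

theory Defs
  imports "HOL-Analysis.Analysis" "HOL-Probability.Probability"
begin

definition countably_generated :: "'a measure \<Rightarrow> bool" where
  "countably_generated M \<longleftrightarrow>
     (\<exists>C. countable C \<and> C \<subseteq> Pow (space M) \<and> sets M = sigma_sets (space M) C)"

definition random_walk_space :: "'a measure \<Rightarrow> ('a \<Rightarrow> 'a measure) \<Rightarrow> 'a measure \<Rightarrow> bool" where
  "random_walk_space M m \<nu> \<longleftrightarrow>
     countably_generated M \<and>
     (\<forall>x\<in>space M. prob_space (m x) \<and> sets (m x) = sets M) \<and>
     (\<forall>A\<in>sets M. (\<lambda>x. emeasure (m x) A) \<in> borel_measurable M) \<and>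
     sets \<nu> = sets M \<and> sigma_finite_measure \<nu> \<and>
     (\<forall>A\<in>sets M. emeasure \<nu> A = (\<integral>\<^sup>+ x. emeasure (m x) A \<partial>\<nu>))"

text \<open>Reversibility: dm_x(y) dnu(x) = dm_y(x) dnu(y) as measures on X x X, expressed by
  equality of the integrals of all nonnegative measurable functions.\<close>
definition reversible :: "'a measure \<Rightarrow> ('a \<Rightarrow> 'a measure) \<Rightarrow> 'a measure \<Rightarrow> bool" where
  "reversible M m \<nu> \<longleftrightarrow>
     (\<forall>f \<in> borel_measurable (M \<Otimes>\<^sub>M M).
        (\<integral>\<^sup>+ x. (\<integral>\<^sup>+ y. f (x, y) \<partial>m x) \<partial>\<nu>) = (\<integral>\<^sup>+ x. (\<integral>\<^sup>+ y. f (y, x) \<partial>m x) \<partial>\<nu>))"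

definition L2 :: "'a measure \<Rightarrow> ('a \<Rightarrow> real) \<Rightarrow> bool" where
  "L2 \<nu> u \<longleftrightarrow> u \<in> borel_measurable \<nu> \<and> integrable \<nu> (\<lambda>x. (u x)\<^sup>2)"

definition L2norm :: "'a measure \<Rightarrow> ('a \<Rightarrow> real) \<Rightarrow> real" where
  "L2norm \<nu> u = sqrt (\<integral>x. (u x)\<^sup>2 \<partial>\<nu>)"

definition mean :: "'a measure \<Rightarrow> ('a \<Rightarrow> real) \<Rightarrow> real" where
  "mean \<nu> u = (\<integral>x. u x \<partial>\<nu>) / measure \<nu> (space \<nu>)"

definition F1 :: "'a measure \<Rightarrow> ('a \<Rightarrow> 'a measure) \<Rightarrow> ('a \<Rightarrow> real) \<Rightarrow> ennreal" where
  "F1 \<nu> m u = ennreal (1/2) * (\<integral>\<^sup>+ x. (\<integral>\<^sup>+ y. ennreal \<bar>u y - u x\<bar> \<partial>m x) \<partial>\<nu>)"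

text \<open>(u,v) in Delta_1^m iff (u,-v) in the L^2(X,nu)-subdifferential of F_{1,m},
  i.e. u,v in L^2, F(u) finite and F(w) >= F(u) + <-v, w - u> for all w in L^2.\<close>
definition Delta1 :: "'a measure \<Rightarrow> ('a \<Rightarrow> 'a measure) \<Rightarrow> ('a \<Rightarrow> real) \<Rightarrow> ('a \<Rightarrow> real) \<Rightarrow> bool" where
  "Delta1 \<nu> m u v \<longleftrightarrow> L2 \<nu> u \<and> L2 \<nu> v \<and> F1 \<nu> m u < \<infinity> \<and>
     (\<forall>w. L2 \<nu> w \<and> F1 \<nu> m w < \<infinity> \<longrightarrow>
        enn2real (F1 \<nu> m u) + (\<integral>x. (- v x) * (w x - u x) \<partial>\<nu>) \<le> enn2real (F1 \<nu> m w))"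

text \<open>(u,w) in Delta_p^m (p > 1); |t|^(p-2) t is written sgn t * |t| powr (p-1).\<close>
definition DeltaP :: "'a measure \<Rightarrow> ('a \<Rightarrow> 'a measure) \<Rightarrow> real \<Rightarrow> ('a \<Rightarrow> real) \<Rightarrow> ('a \<Rightarrow> real) \<Rightarrow> bool" where
  "DeltaP \<nu> m p u w \<longleftrightarrow> L2 \<nu> u \<and> L2 \<nu> w \<and>
     (\<integral>\<^sup>+ x. (\<integral>\<^sup>+ y. ennreal (\<bar>u y - u x\<bar> powr p) \<partial>m x) \<partial>\<nu>) < \<infinity> \<and>
     (AE x in \<nu>. w x = (\<integral>y. sgn (u y - u x) * \<bar>u y - u x\<bar> powr (p - 1) \<partial>m x))"

definition Aop :: "'a measure \<Rightarrow> ('a \<Rightarrow> 'a measure) \<Rightarrow> 'a measure \<Rightarrow> ('a \<Rightarrow> 'a measure)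
    \<Rightarrow> ('a \<Rightarrow> real) \<Rightarrow> real \<Rightarrow> ('a \<Rightarrow> real) \<Rightarrow> ('a \<Rightarrow> real) \<Rightarrow> bool" where
  "Aop \<nu>1 m1 \<nu>2 m2 \<mu> p u v \<longleftrightarrow> L2 \<nu>1 u \<and> L2 \<nu>1 v \<and>
     (\<exists>v1 w. Delta1 \<nu>1 m1 u (\<lambda>x. - v1 x) \<and> DeltaP \<nu>2 m2 p u w \<and>
        (AE x in \<nu>1. v x = v1 x - \<mu> x * w x))"

text \<open>Strong solution: u in C([0,oo);H) with u(t) in H, u in W^{1,2}_loc(0,oo;H) with
  derivative g (represented as a jointly measurable function of (t,x), locally square
  integrable on (0,oo) x X, with u(t) - u(s) = int_s^t g), u(0) = u0 and
  -u_t(t) in A(u(t)) for a.e. t > 0.\<close>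
definition strong_solution :: "'a measure \<Rightarrow> ('a \<Rightarrow> 'a measure) \<Rightarrow> 'a measure \<Rightarrow> ('a \<Rightarrow> 'a measure)
    \<Rightarrow> ('a \<Rightarrow> real) \<Rightarrow> real \<Rightarrow> ('a \<Rightarrow> real) \<Rightarrow> (real \<Rightarrow> 'a \<Rightarrow> real) \<Rightarrow> bool" where
  "strong_solution \<nu>1 m1 \<nu>2 m2 \<mu> p u0 u \<longleftrightarrow>
     (\<forall>t\<ge>0. L2 \<nu>1 (u t)) \<and>
     (\<forall>t\<ge>0. ((\<lambda>s. L2norm \<nu>1 (\<lambda>x. u s x - u t x)) \<longlongrightarrow> 0) (at t within {0..})) \<and>
     (AE x in \<nu>1. u 0 x = u0 x) \<and>
     (\<exists>g :: real \<Rightarrow> 'a \<Rightarrow> real.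
        (\<lambda>(t, x). g t x) \<in> borel_measurable (lborel \<Otimes>\<^sub>M \<nu>1) \<and>
        (\<forall>a b. 0 < a \<longrightarrow> a < b \<longrightarrow>
           (\<integral>\<^sup>+ t. indicator {a..b} t * (\<integral>\<^sup>+ x. ennreal ((g t x)\<^sup>2) \<partial>\<nu>1) \<partial>lborel) < \<infinity>) \<and>
        (\<forall>s t. 0 < s \<longrightarrow> s \<le> t \<longrightarrow>
           (AE x in \<nu>1. u t x - u s x = (LINT \<tau>:{s..t}|lborel. g \<tau> x))) \<and>
        (AE t in lborel. 0 < t \<longrightarrow> Aop \<nu>1 m1 \<nu>2 m2 \<mu> p (u t) (\<lambda>x. - g t x)))"

definition poincare :: "'a measure \<Rightarrow> ('a \<Rightarrow> 'a measure) \<Rightarrow> real \<Rightarrow> real \<Rightarrow> bool" where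
  "poincare \<nu> m r lam \<longleftrightarrow> lam > 0 \<and>
     (\<forall>u. u \<in> borel_measurable \<nu> \<and> integrable \<nu> (\<lambda>x. \<bar>u x\<bar> powr r) \<longrightarrow>
        ennreal (lam * (\<integral>x. \<bar>u x - mean \<nu> u\<bar> powr r \<partial>\<nu>) powr (1 / r)) \<le> F1 \<nu> m u)"

end

theory Submission
  imports Defs
begin

text \<open>
  Testing the subdifferential inequality with the constant \<open>C\<close> and with the translates of \<open>u\<close>
  shows that an element \<open>v\<^sub>1\<close> of the subdifferential has integral zero and satisfies
  \<open>F(u) \<le> \<integral> v\<^sub>1 (u - C)\<close>. By reversibility, the p-Laplacian has integral zero and its pairing with
  \<open>u\<close> is nonpositive. Hence the mean of \<open>u(t)\<close> is conserved and, with \<open>C\<close> this mean and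
  \<open>y(t)\<close> the \<open>L\<^sup>2\<close> norm of \<open>u(t) - C\<close>, the Poincare inequality gives
  \<open>(y\<^sup>2)' \<le> - 2 lam y\<close> almost everywhere, that is, \<open>y' \<le> - lam\<close> as long as \<open>y > 0\<close>.
\<close>

subsection \<open>Square-integrable functions\<close>

text \<open>The inequality for y' is only heuristic, since the norm is not differentiable where it
  vanishes. What is proved is an integrated inequality for the square of y on every interval of
  positive times; fine partitions then turn it into linear decay. Time 0 is reached only through
  continuity in the L2 norm, because the time derivative is controlled only locally on (0, oo). The
  Poincare inequality measures the distance to the current mean of u(t), so conservation of the mean
  has to precede dissipation. The weight \<open>\<mu>\<close> is the density of
  \<open>\<nu>2\<close> with respect to \<open>\<nu>1\<close>: pairing \<open>\<mu> * w\<close> in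
  \<open>\<nu>1\<close> is pairing \<open>w\<close> in \<open>\<nu>2\<close>, the measure for which
  \<open>m2\<close> is reversible. Boundedness of \<open>\<mu>\<close> makes \<open>\<nu>2\<close>
  finite, and then the power p - 1 of the gradient is integrable as soon as the power p is.\<close>

lemma L2_measurable [measurable_dest]: "L2 M f \<Longrightarrow> f \<in> borel_measurable M"
  by (simp add: L2_def)

lemma L2_integrable_sq: "L2 M f \<Longrightarrow> integrable M (\<lambda>x. (f x)\<^sup>2)"
  by (simp add: L2_def)

lemma L2_integrable_mult:
  assumes "L2 M f" "L2 M h"
  shows "integrable M (\<lambda>x. f x * h x)"
proof (rule Bochner_Integration.integrable_bound)
  show "integrable M (\<lambda>x. (f x)\<^sup>2 + (h x)\<^sup>2)"
    using assms by (intro Bochner_Integration.integrable_add L2_integrable_sq)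
  show "(\<lambda>x. f x * h x) \<in> borel_measurable M"
    using assms[THEN L2_measurable] by measurable
  have "\<bar>a * b\<bar> \<le> a\<^sup>2 + b\<^sup>2" for a b :: real
    using sum_squares_bound[of "\<bar>a\<bar>" "\<bar>b\<bar>"] mult_nonneg_nonneg[OF abs_ge_zero[of a] abs_ge_zero[of b]]
    unfolding abs_mult power2_abs by linarith
  then show "AE x in M. norm (f x * h x) \<le> norm ((f x)\<^sup>2 + (h x)\<^sup>2)"
    by (intro AE_I2) (metis abs_ge_self order_trans real_norm_def)
qed

lemma L2_add:
  assumes "L2 M f" "L2 M h"
  shows "L2 M (\<lambda>x. f x + h x)"
proof -
  have "integrable M (\<lambda>x. (f x)\<^sup>2 + (h x)\<^sup>2 + 2 * (f x * h x))"
    using assms by (intro Bochner_Integration.integrable_add integrable_mult_right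
        L2_integrable_sq L2_integrable_mult)
  then have "integrable M (\<lambda>x. (f x + h x)\<^sup>2)"
    by (simp add: power2_sum mult.assoc)
  then show ?thesis
    using assms[THEN L2_measurable] by (simp add: L2_def)
qed

lemma L2_cmult: "L2 M f \<Longrightarrow> L2 M (\<lambda>x. c * f x)"
  by (auto simp: L2_def power_mult_distrib)

lemma L2_diff:
  assumes "L2 M f" "L2 M h"
  shows "L2 M (\<lambda>x. f x - h x)"
  using L2_add[OF assms(1) L2_cmult[OF assms(2), of "-1"]] by simp

lemma (in finite_measure) L2_const: "L2 M (\<lambda>_. c)"
  by (simp add: L2_def)

lemma (in finite_measure) L2_integrable: "L2 M f \<Longrightarrow> integrable M f"
  using L2_integrable_mult[OF _ L2_const[of 1]] by simp

lemma L2norm_nonneg: "0 \<le> L2norm M f"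
  by (simp add: L2norm_def)

lemma L2norm_sq: "(L2norm M f)\<^sup>2 = (\<integral>x. (f x)\<^sup>2 \<partial>M)"
  by (simp add: L2norm_def)

lemma L2norm_cong_AE:
  assumes "AE x in M. f x = h x" "f \<in> borel_measurable M" "h \<in> borel_measurable M"
  shows "L2norm M f = L2norm M h"
proof -
  have "(\<integral>x. (f x)\<^sup>2 \<partial>M) = (\<integral>x. (h x)\<^sup>2 \<partial>M)"
    using assms by (intro integral_cong_AE) auto
  then show ?thesis by (simp add: L2norm_def)
qed

lemma L2norm_zero_AE:
  assumes "L2 M f" "L2norm M f = 0"
  shows "AE x in M. f x = 0"
proof -
  have "(\<integral>x. (f x)\<^sup>2 \<partial>M) = 0"
    using L2norm_sq[of M f] assms(2) by simp
  then have "AE x in M. (f x)\<^sup>2 = 0"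
    using integral_nonneg_eq_0_iff_AE[OF L2_integrable_sq[OF assms(1)]] by simp
  then show ?thesis by simp
qed

lemma L2_Cauchy_Schwarz:
  assumes f: "L2 M f" and h: "L2 M h"
  shows "\<bar>\<integral>x. f x * h x \<partial>M\<bar> \<le> L2norm M f * L2norm M h"
proof -
  define a b c where "a = (\<integral>x. (f x)\<^sup>2 \<partial>M)" "b = (\<integral>x. f x * h x \<partial>M)" "c = (\<integral>x. (h x)\<^sup>2 \<partial>M)"
  have [simp]: "integrable M (\<lambda>x. (f x)\<^sup>2)" "integrable M (\<lambda>x. (h x)\<^sup>2)" "integrable M (\<lambda>x. f x * h x)"
    using f h by (auto intro: L2_integrable_sq L2_integrable_mult)
  have quad: "0 \<le> s\<^sup>2 * a + 2 * s * r * b + r\<^sup>2 * c" for s r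
  proof -
    have "0 \<le> (\<integral>x. (s * f x + r * h x)\<^sup>2 \<partial>M)" by simp
    also have "\<dots> = (\<integral>x. s\<^sup>2 * (f x)\<^sup>2 + 2 * s * r * (f x * h x) + r\<^sup>2 * (h x)\<^sup>2 \<partial>M)"
      by (intro Bochner_Integration.integral_cong) (auto simp: power2_eq_square algebra_simps)
    also have "\<dots> = s\<^sup>2 * a + 2 * s * r * b + r\<^sup>2 * c"
      by (simp add: a_b_c_def)
    finally show ?thesis .
  qed
  have a0: "0 \<le> a" and c0: "0 \<le> c" by (auto simp: a_b_c_def)
  have "b\<^sup>2 \<le> a * c"
  proof (cases "a = 0")
    case True
    have "b = 0"
    proof (rule ccontr)
      assume "b \<noteq> 0"
      \<comment> \<open>With a = 0 the form is linear in s; this s makes it equal to -(c + 1) + c =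
        -1.\<close>
      then show False
        using quad[of "-(c + 1) / (2 * b)" 1] True by (simp add: field_simps)
    qed
    then show ?thesis using True by simp
  next
    case False
    then have "a > 0" using a0 by simp
    \<comment> \<open>For fixed r = -a the form is minimal in s at s = b.\<close>
    have "0 \<le> b\<^sup>2 * a + 2 * b * (- a) * b + (-a)\<^sup>2 * c" by (rule quad)
    then have "0 \<le> a * (a * c - b\<^sup>2)" by (simp add: power2_eq_square algebra_simps)
    then show ?thesis using \<open>a > 0\<close> by (simp add: zero_le_mult_iff)
  qed
  then have "\<bar>b\<bar> \<le> sqrt (a * c)" using real_sqrt_le_mono by fastforce
  then show ?thesis by (simp add: L2norm_def a_b_c_def real_sqrt_mult)
qed

lemma L2norm_add_le:
  assumes f: "L2 M f" and h: "L2 M h"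
  shows "L2norm M (\<lambda>x. f x + h x) \<le> L2norm M f + L2norm M h"
proof (rule power2_le_imp_le)
  have [simp]: "integrable M (\<lambda>x. (f x)\<^sup>2)" "integrable M (\<lambda>x. (h x)\<^sup>2)" "integrable M (\<lambda>x. f x * h x)"
    using f h by (auto intro: L2_integrable_sq L2_integrable_mult)
  have "(L2norm M (\<lambda>x. f x + h x))\<^sup>2 = (\<integral>x. (f x)\<^sup>2 + (h x)\<^sup>2 + 2 * (f x * h x) \<partial>M)"
    unfolding L2norm_sq
    by (intro Bochner_Integration.integral_cong) (auto simp: power2_eq_square algebra_simps)
  also have "\<dots> = (L2norm M f)\<^sup>2 + (L2norm M h)\<^sup>2 + 2 * (\<integral>x. f x * h x \<partial>M)"
    by (simp add: L2norm_sq)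
  also have "\<dots> \<le> (L2norm M f + L2norm M h)\<^sup>2"
    using L2_Cauchy_Schwarz[OF f h] by (simp add: power2_sum)
  finally show "(L2norm M (\<lambda>x. f x + h x))\<^sup>2 \<le> (L2norm M f + L2norm M h)\<^sup>2" .
qed (simp add: L2norm_nonneg)

lemma L2norm_minus: "L2norm M (\<lambda>x. - f x) = L2norm M f"
  by (simp add: L2norm_def)

lemma abs_L2norm_diff_le:
  assumes f: "L2 M f" and h: "L2 M h"
  shows "\<bar>L2norm M f - L2norm M h\<bar> \<le> L2norm M (\<lambda>x. f x - h x)"
proof -
  have "L2norm M f \<le> L2norm M (\<lambda>x. f x - h x) + L2norm M h"
    using L2norm_add_le[OF L2_diff[OF f h] h] by simp
  moreover have "L2norm M h \<le> L2norm M (\<lambda>x. h x - f x) + L2norm M f"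
    using L2norm_add_le[OF L2_diff[OF h f] f] by simp
  moreover have "L2norm M (\<lambda>x. h x - f x) = L2norm M (\<lambda>x. f x - h x)"
    using L2norm_minus[of M "\<lambda>x. f x - h x"] by simp
  ultimately show ?thesis by linarith
qed

subsection \<open>Extinction from a differential inequality in difference form\<close>

text \<open>With \<open>h\<close> the step of an equidistant partition, the hypothesis on one step reads
  \<open>(y a)\<^sup>2 \<ge> (y b + lam * h)\<^sup>2 - (lam * h)\<^sup>2\<close>; the quadratic error, summed over the \<open>k\<close> steps, is of
  order \<open>1 / k\<close>.\<close>

lemma linear_decay_of_quadratic_decay:
  fixes y :: "real \<Rightarrow> real"
  assumes lam: "lam > 0" and st: "s \<le> t" and nonneg: "\<And>r. 0 \<le> y r"
    and decay: "\<And>a b. s \<le> a \<Longrightarrow> a \<le> b \<Longrightarrow> b \<le> t \<Longrightarrow> (y b)\<^sup>2 + 2 * lam * (b - a) * y b \<le> (y a)\<^sup>2"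
  shows "y t \<le> max 0 (y s - lam * (t - s))"
proof (cases "y t = 0")
  case False
  \<comment> \<open>The final value is positive here and, y being decreasing, bounds y from below on
    the whole interval. This makes the division by d legitimate.\<close>
  define d where "d = y t"
  have d: "d > 0" using False nonneg[of t] by (simp add: d_def)
  have antimono: "d \<le> y a" if "s \<le> a" "a \<le> t" for a
  proof (rule power2_le_imp_le)
    have "0 \<le> 2 * lam * (t - a) * y t" using that lam nonneg[of t] by simp
    then show "d\<^sup>2 \<le> (y a)\<^sup>2" using decay[of a t] that unfolding d_def by linarith
  qed (rule nonneg)
  have step: "y b + lam * (b - a) - (lam * (b - a))\<^sup>2 / d \<le> y a"
    if ab: "s \<le> a" "a \<le> b" "b \<le> t" for a b
  proof (rule ccontr)
    assume neg: "\<not> ?thesis"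
    define e where "e = lam * (b - a)"
    have e0: "e \<ge> 0" using ab lam by (simp add: e_def)
    have yb: "y b \<ge> d" using antimono ab by simp
    have lt: "y a < y b + e - e\<^sup>2 / d" using neg by (simp add: e_def)
    have ya: "y a \<ge> d" using antimono ab by simp
    have eq: "(y b)\<^sup>2 + 2 * e * y b \<le> (y a)\<^sup>2" using decay[OF ab] by (simp add: e_def)
    \<comment> \<open>The hypothesis, completed to a square, is a difference of squares. The second
      factor is at least d, which forces the first to be at most
      \<open>e\<^sup>2 / d\<close>.\<close>
    have "(y b + e - y a) * (y b + e + y a) \<le> e\<^sup>2"
      using eq by (simp add: power2_eq_square algebra_simps)
    moreover have "e\<^sup>2 / d * d < (y b + e - y a) * (y b + e + y a)"
    proof -
      have "e\<^sup>2 / d * d \<le> e\<^sup>2 / d * (y b + e + y a)"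
        using ya yb d e0 by (intro mult_left_mono) auto
      also have "\<dots> < (y b + e - y a) * (y b + e + y a)"
        using lt ya yb d e0 by (intro mult_strict_right_mono) auto
      finally show ?thesis .
    qed
    ultimately show False using d by simp
  qed
  have bound: "d + lam * (t - s) - (lam * (t - s))\<^sup>2 / d * inverse (real (Suc k)) \<le> y s" for k
  proof -
    define h where "h = (t - s) / Suc k"
    have h: "h \<ge> 0" "Suc k * h = t - s" using st by (auto simp: h_def)
    \<comment> \<open>The chain runs backwards from t, because \<open>step\<close> bounds y at the
      left end of a subinterval from below by its value at the right end.\<close>
    have "d + real j * (lam * h - (lam * h)\<^sup>2 / d) \<le> y (t - j * h)" if "j \<le> Suc k" for j
      using that
    proof (induction j)
      case (Suc j)
      have "real (Suc j) * h \<le> Suc k * h"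
        using Suc.prems h by (intro mult_right_mono) auto
      then have "s \<le> t - Suc j * h" using h by linarith
      moreover have "t - Suc j * h \<le> t - j * h" using h by (simp add: algebra_simps)
      moreover have "t - j * h \<le> t" using h by simp
      ultimately have "y (t - j * h) + lam * (t - j * h - (t - Suc j * h))
          - (lam * (t - j * h - (t - Suc j * h)))\<^sup>2 / d \<le> y (t - Suc j * h)"
        by (rule step)
      moreover have "t - j * h - (t - Suc j * h) = h" by (simp add: algebra_simps)
      ultimately show ?case using Suc by (simp add: algebra_simps add_divide_distrib)
    qed (simp add: d_def)
    from this[of "Suc k"] have "d + real (Suc k) * (lam * h - (lam * h)\<^sup>2 / d) \<le> y (t - (t - s))"
      using h by simp
    moreover have "real (Suc k) * (lam * h) = lam * (t - s)"
      unfolding h(2)[symmetric] by (simp only: mult_ac)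
    moreover have "real (Suc k) * ((lam * h)\<^sup>2 / d) = (lam * (t - s))\<^sup>2 / d * inverse (real (Suc k))"
      unfolding h(2)[symmetric] by (simp add: power2_eq_square del: of_nat_Suc)
    ultimately show ?thesis by (simp only: right_diff_distrib) simp
  qed
  have "(\<lambda>k. d + lam * (t - s) - (lam * (t - s))\<^sup>2 / d * inverse (real (Suc k)))
      \<longlonglongrightarrow> d + lam * (t - s) - (lam * (t - s))\<^sup>2 / d * 0"
    by (intro tendsto_intros LIMSEQ_inverse_real_of_nat)
  then have "d + lam * (t - s) - (lam * (t - s))\<^sup>2 / d * 0 \<le> y s"
    by (rule LIMSEQ_le_const2) (use bound in blast)
  then show ?thesis by (simp add: d_def)
qed simp

subsection \<open>The edge measure of a random walk\<close>

text \<open>The measure dm_x(y) d\<nu>(x) on pairs. Having it as a single measure gives a meaning to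
  integrability of signed functions of an edge, which iterated integrals alone do not
  express.\<close>

definition edge_measure :: "('a \<Rightarrow> 'a measure) \<Rightarrow> 'a measure \<Rightarrow> ('a \<times> 'a) measure" where
  "edge_measure m \<nu> = \<nu> \<bind> (\<lambda>x. distr (m x) (\<nu> \<Otimes>\<^sub>M \<nu>) (Pair x))"

text \<open>Everything is phrased over \<open>\<nu>\<close> itself, with the kernel as a measurable
  map into \<open>subprob_algebra \<nu>\<close>, so that the monadic \<open>bind\<close> applies to
  it.\<close>

locale walk =
  fixes m :: "'a \<Rightarrow> 'a measure" and \<nu> :: "'a measure"
  assumes kernel_measurable [measurable]: "m \<in> measurable \<nu> (subprob_algebra \<nu>)"
    and kernel_prob: "x \<in> space \<nu> \<Longrightarrow> prob_space (m x)"
    and symmetric: "f \<in> borel_measurable (\<nu> \<Otimes>\<^sub>M \<nu>) \<Longrightarrow>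
      (\<integral>\<^sup>+ x. (\<integral>\<^sup>+ y. f (x, y) \<partial>m x) \<partial>\<nu>) = (\<integral>\<^sup>+ x. (\<integral>\<^sup>+ y. f (y, x) \<partial>m x) \<partial>\<nu>)"
begin

lemma sets_kernel_eq [simp]: "x \<in> space \<nu> \<Longrightarrow> sets (m x) = sets \<nu>"
  using sets_kernel[OF kernel_measurable] .

lemma space_kernel [simp]: "x \<in> space \<nu> \<Longrightarrow> space (m x) = space \<nu>"
  using sets_kernel_eq by (rule sets_eq_imp_space_eq)

lemma edge_kernel_measurable:
  "(\<lambda>x. distr (m x) (\<nu> \<Otimes>\<^sub>M \<nu>) (Pair x)) \<in> measurable \<nu> (subprob_algebra (\<nu> \<Otimes>\<^sub>M \<nu>))"
  by (rule measurable_distr2[OF _ kernel_measurable]) simp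

lemma sets_edge_measure [simp, measurable_cong]: "sets (edge_measure m \<nu>) = sets (\<nu> \<Otimes>\<^sub>M \<nu>)"
proof (cases "space \<nu> = {}")
  \<comment> \<open>Over an empty space \<open>bind\<close> returns the default
    \<open>count_space {}\<close>, so this case is not covered by \<open>sets_bind\<close>.\<close>
  case True
  then have "space (\<nu> \<Otimes>\<^sub>M \<nu>) = {}" by (simp add: space_pair_measure)
  then show ?thesis
    using True by (simp add: edge_measure_def bind_empty space_empty_iff)
next
  case False
  then show ?thesis
    unfolding edge_measure_def by (intro sets_bind) auto
qed

lemma space_edge_measure [simp]: "space (edge_measure m \<nu>) = space \<nu> \<times> space \<nu>"
  using sets_eq_imp_space_eq[OF sets_edge_measure] by (simp add: space_pair_measure)

lemma nn_integral_edge_measure: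
  assumes f [measurable]: "f \<in> borel_measurable (\<nu> \<Otimes>\<^sub>M \<nu>)"
  shows "(\<integral>\<^sup>+ z. f z \<partial>edge_measure m \<nu>) = (\<integral>\<^sup>+ x. (\<integral>\<^sup>+ y. f (x, y) \<partial>m x) \<partial>\<nu>)"
proof -
  have "(\<integral>\<^sup>+ z. f z \<partial>edge_measure m \<nu>)
      = (\<integral>\<^sup>+ x. (\<integral>\<^sup>+ z. f z \<partial>distr (m x) (\<nu> \<Otimes>\<^sub>M \<nu>) (Pair x)) \<partial>\<nu>)"
    unfolding edge_measure_def by (rule nn_integral_bind[OF f edge_kernel_measurable])
  also have "\<dots> = (\<integral>\<^sup>+ x. (\<integral>\<^sup>+ y. f (x, y) \<partial>m x) \<partial>\<nu>)"
    by (intro nn_integral_cong nn_integral_distr)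
       (auto simp: measurable_cong_sets[OF sets_kernel_eq refl])
  finally show ?thesis .
qed

lemma emeasure_edge_measure: "emeasure (edge_measure m \<nu>) (space (edge_measure m \<nu>)) = emeasure \<nu> (space \<nu>)"
proof -
  have "emeasure (edge_measure m \<nu>) (space (edge_measure m \<nu>)) = (\<integral>\<^sup>+ x. (\<integral>\<^sup>+ y. 1 \<partial>m x) \<partial>\<nu>)"
    using nn_integral_edge_measure[of "\<lambda>_. 1"] by simp
  also have "\<dots> = (\<integral>\<^sup>+ x. 1 \<partial>\<nu>)"
    using prob_space.emeasure_space_1[OF kernel_prob] by (intro nn_integral_cong) simp
  finally show ?thesis by simp
qed

lemma nn_integral_kernel_measurable:
  assumes "f \<in> borel_measurable (\<nu> \<Otimes>\<^sub>M \<nu>)"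
  shows "(\<lambda>x. \<integral>\<^sup>+ y. f (x, y) \<partial>m x) \<in> borel_measurable \<nu>"
  using assms by (intro nn_integral_measurable_subprob_algebra2[OF _ kernel_measurable]) simp

lemma integral_kernel_measurable:
  fixes f :: "'a \<times> 'a \<Rightarrow> real"
  assumes f [measurable]: "f \<in> borel_measurable (\<nu> \<Otimes>\<^sub>M \<nu>)"
  shows "(\<lambda>x. \<integral>y. f (x, y) \<partial>m x) \<in> borel_measurable \<nu>"
proof -
  define P N where "P = (\<lambda>x. \<integral>\<^sup>+ y. ennreal (f (x, y)) \<partial>m x)"
    and "N = (\<lambda>x. \<integral>\<^sup>+ y. ennreal (- f (x, y)) \<partial>m x)"
  have [measurable]: "P \<in> borel_measurable \<nu>" "N \<in> borel_measurable \<nu>"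
    unfolding P_def N_def
    by (auto intro!: nn_integral_kernel_measurable[of "\<lambda>z. ennreal (f z)"]
        nn_integral_kernel_measurable[of "\<lambda>z. ennreal (- f z)"])
  \<comment> \<open>The branch with value 0 is the default of the integral for sections that are not
    integrable; no integrability of \<open>f\<close> is assumed here.\<close>
  have "(\<integral>y. f (x, y) \<partial>m x)
      = (if P x \<noteq> \<infinity> \<and> N x \<noteq> \<infinity> then enn2real (P x) - enn2real (N x) else 0)"
    if "x \<in> space \<nu>" for x
  proof -
    have "(\<lambda>y. f (x, y)) \<in> borel_measurable (m x)"
      using that by (simp add: measurable_cong_sets[OF sets_kernel_eq[OF that] refl])
    then have "integrable (m x) (\<lambda>y. f (x, y)) \<longleftrightarrow> P x \<noteq> \<infinity> \<and> N x \<noteq> \<infinity>"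
      by (simp add: real_integrable_def P_def N_def)
    then show ?thesis
      by (auto simp: real_lebesgue_integral_def not_integrable_integral_eq P_def N_def)
  qed
  then show ?thesis by (subst measurable_cong) auto
qed

text \<open>Positive and negative parts are treated separately by the formula for nonnegative
  functions. Their section integrals \<open>P\<close> and \<open>N\<close> are finite only almost
  everywhere, hence the passage through \<open>enn2real\<close>.\<close>

lemma integral_edge_measure:
  fixes f :: "'a \<times> 'a \<Rightarrow> real"
  assumes f: "integrable (edge_measure m \<nu>) f"
  shows "(\<integral>x. (\<integral>y. f (x, y) \<partial>m x) \<partial>\<nu>) = (\<integral>z. f z \<partial>edge_measure m \<nu>)"
proof -
  have [measurable]: "f \<in> borel_measurable (\<nu> \<Otimes>\<^sub>M \<nu>)"
    using borel_measurable_integrable[OF f] by (simp cong: measurable_cong_sets)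
  have f_sec: "(\<lambda>y. f (x, y)) \<in> borel_measurable (m x)" if "x \<in> space \<nu>" for x
    using that by (simp add: measurable_cong_sets[OF sets_kernel_eq[OF that] refl])
  define P N where "P = (\<lambda>x. \<integral>\<^sup>+ y. ennreal (f (x, y)) \<partial>m x)"
    and "N = (\<lambda>x. \<integral>\<^sup>+ y. ennreal (- f (x, y)) \<partial>m x)"
  have [measurable]: "P \<in> borel_measurable \<nu>" "N \<in> borel_measurable \<nu>"
    unfolding P_def N_def
    by (auto intro!: nn_integral_kernel_measurable[of "\<lambda>z. ennreal (f z)"]
        nn_integral_kernel_measurable[of "\<lambda>z. ennreal (- f z)"])
  have iP: "(\<integral>\<^sup>+ x. P x \<partial>\<nu>) = (\<integral>\<^sup>+ z. ennreal (f z) \<partial>edge_measure m \<nu>)"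
    and iN: "(\<integral>\<^sup>+ x. N x \<partial>\<nu>) = (\<integral>\<^sup>+ z. ennreal (- f z) \<partial>edge_measure m \<nu>)"
    unfolding P_def N_def by (simp_all add: nn_integral_edge_measure)
  have finP: "(\<integral>\<^sup>+ x. P x \<partial>\<nu>) \<noteq> \<infinity>" and finN: "(\<integral>\<^sup>+ x. N x \<partial>\<nu>) \<noteq> \<infinity>"
    using f unfolding iP iN real_integrable_def by auto
  have aeP: "AE x in \<nu>. P x \<noteq> \<infinity>" and aeN: "AE x in \<nu>. N x \<noteq> \<infinity>"
    by (rule nn_integral_PInf_AE[OF _ finP], simp, rule nn_integral_PInf_AE[OF _ finN], simp)
  have eqP: "(\<integral>\<^sup>+ x. ennreal (enn2real (P x)) \<partial>\<nu>) = (\<integral>\<^sup>+ x. P x \<partial>\<nu>)"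
    using aeP by (intro nn_integral_cong_AE) (auto simp: less_top)
  have eqN: "(\<integral>\<^sup>+ x. ennreal (enn2real (N x)) \<partial>\<nu>) = (\<integral>\<^sup>+ x. N x \<partial>\<nu>)"
    using aeN by (intro nn_integral_cong_AE) (auto simp: less_top)
  have intP: "integrable \<nu> (\<lambda>x. enn2real (P x))"
    using eqP finP by (intro integrableI_nonneg) (auto simp: less_top)
  have intN: "integrable \<nu> (\<lambda>x. enn2real (N x))"
    using eqN finN by (intro integrableI_nonneg) (auto simp: less_top)
  have "(\<integral>x. (\<integral>y. f (x, y) \<partial>m x) \<partial>\<nu>) = (\<integral>x. enn2real (P x) - enn2real (N x) \<partial>\<nu>)"
  proof (rule Bochner_Integration.integral_cong_AE)
    show "AE x in \<nu>. (\<integral>y. f (x, y) \<partial>m x) = enn2real (P x) - enn2real (N x)"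
      using aeP aeN AE_space
      by eventually_elim (auto simp: real_lebesgue_integral_def real_integrable_def f_sec P_def N_def)
    show "(\<lambda>x. \<integral>y. f (x, y) \<partial>m x) \<in> borel_measurable \<nu>"
      by (rule integral_kernel_measurable) simp
  qed measurable
  also have "\<dots> = enn2real (\<integral>\<^sup>+ x. P x \<partial>\<nu>) - enn2real (\<integral>\<^sup>+ x. N x \<partial>\<nu>)"
    using intP intN eqP eqN by (simp add: integral_eq_nn_integral)
  also have "\<dots> = (\<integral>z. f z \<partial>edge_measure m \<nu>)"
    using f by (simp add: real_lebesgue_integral_def iP iN)
  finally show ?thesis .
qed

text \<open>Reversibility speaks of nonnegative functions; applied to the positive and the negative
  part it extends to signed integrable ones.\<close>

lemma edge_measure_swap:
  fixes f :: "'a \<times> 'a \<Rightarrow> real"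
  assumes f: "integrable (edge_measure m \<nu>) f"
  shows "integrable (edge_measure m \<nu>) (\<lambda>z. f (snd z, fst z))"
    and "(\<integral>z. f (snd z, fst z) \<partial>edge_measure m \<nu>) = (\<integral>z. f z \<partial>edge_measure m \<nu>)"
proof -
  have [measurable]: "f \<in> borel_measurable (\<nu> \<Otimes>\<^sub>M \<nu>)"
    using borel_measurable_integrable[OF f] by (simp cong: measurable_cong_sets)
  have nn: "(\<integral>\<^sup>+ z. g (snd z, fst z) \<partial>edge_measure m \<nu>) = (\<integral>\<^sup>+ z. g z \<partial>edge_measure m \<nu>)"
    if [measurable]: "g \<in> borel_measurable (\<nu> \<Otimes>\<^sub>M \<nu>)" for g :: "'a \<times> 'a \<Rightarrow> ennreal"
    using symmetric[OF that] by (simp add: nn_integral_edge_measure)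
  have nn': "(\<integral>\<^sup>+ z. ennreal (f (snd z, fst z)) \<partial>edge_measure m \<nu>) = (\<integral>\<^sup>+ z. ennreal (f z) \<partial>edge_measure m \<nu>)"
    "(\<integral>\<^sup>+ z. ennreal (- f (snd z, fst z)) \<partial>edge_measure m \<nu>) = (\<integral>\<^sup>+ z. ennreal (- f z) \<partial>edge_measure m \<nu>)"
    using nn[of "\<lambda>z. ennreal (f z)"] nn[of "\<lambda>z. ennreal (- f z)"] by simp_all
  show int: "integrable (edge_measure m \<nu>) (\<lambda>z. f (snd z, fst z))"
    using f by (simp add: real_integrable_def nn' cong: measurable_cong_sets)
  show "(\<integral>z. f (snd z, fst z) \<partial>edge_measure m \<nu>) = (\<integral>z. f z \<partial>edge_measure m \<nu>)"
    using f int by (simp add: real_lebesgue_integral_def nn')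
qed

subsection \<open>Dissipativity of the p-Laplacian\<close>

text \<open>This is integration by parts on the graph. The flux \<open>\<phi>\<close> is
  antisymmetric, so symmetrizing the edge integral leaves minus one half of the flux times the
  increment of \<open>h\<close> along \<open>u\<close>, and the two have the same sign. Boundedness
  of \<open>h\<close> keeps the product integrable, as \<open>\<phi>\<close> is only known to be in
  L1.\<close>

lemma DeltaP_monotone_test:
  fixes h :: "real \<Rightarrow> real"
  assumes p: "p > 1" and fin: "emeasure \<nu> (space \<nu>) < \<infinity>"
    and D: "DeltaP \<nu> m p u w"
    and h: "mono h" "\<And>a. \<bar>h a\<bar> \<le> K"
  shows "(\<integral>x. w x * h (u x) \<partial>\<nu>) \<le> 0"
proof -
  let ?P = "edge_measure m \<nu>"
  interpret P: finite_measure ?P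
    using fin emeasure_edge_measure by (intro finite_measureI) auto
  have u [measurable]: "u \<in> borel_measurable \<nu>" and w [measurable]: "w \<in> borel_measurable \<nu>"
    using D by (auto simp: DeltaP_def L2_def)
  have h' [measurable]: "h \<in> borel_measurable borel"
    using h(1) by (rule borel_measurable_mono)
  define \<phi> where "\<phi> = (\<lambda>(x, y). sgn (u y - u x) * \<bar>u y - u x\<bar> powr (p - 1))"
  have \<phi> [measurable]: "\<phi> \<in> borel_measurable (\<nu> \<Otimes>\<^sub>M \<nu>)"
    unfolding \<phi>_def split_beta by measurable
  \<comment> \<open>Constants are integrable against the finite edge measure, so this domination
    derives integrability of \<open>\<phi>\<close> from the finite p-energy.\<close>
  have bound: "\<bar>a\<bar> powr (p - 1) \<le> 1 + \<bar>a\<bar> powr p" for a :: real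
  proof (cases "\<bar>a\<bar> \<le> 1")
    case True
    then have "\<bar>a\<bar> powr (p - 1) \<le> 1" using p by (intro powr_le1) auto
    then show ?thesis by (simp add: add_increasing2)
  next
    case False
    then have "\<bar>a\<bar> powr (p - 1) \<le> \<bar>a\<bar> powr p" by (intro powr_mono) auto
    then show ?thesis by simp
  qed
  have "integrable ?P (\<lambda>z. \<bar>u (snd z) - u (fst z)\<bar> powr p)"
  proof (rule integrableI_nonneg)
    show "(\<lambda>z. \<bar>u (snd z) - u (fst z)\<bar> powr p) \<in> borel_measurable ?P" by measurable
    have "(\<integral>\<^sup>+ z. ennreal (\<bar>u (snd z) - u (fst z)\<bar> powr p) \<partial>?P)
        = (\<integral>\<^sup>+ x. (\<integral>\<^sup>+ y. ennreal (\<bar>u y - u x\<bar> powr p) \<partial>m x) \<partial>\<nu>)"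
      by (subst nn_integral_edge_measure) auto
    then show "(\<integral>\<^sup>+ z. ennreal (\<bar>u (snd z) - u (fst z)\<bar> powr p) \<partial>?P) < \<infinity>"
      using D by (simp add: DeltaP_def)
  qed simp
  then have "integrable ?P (\<lambda>z. 1 + \<bar>u (snd z) - u (fst z)\<bar> powr p)" by simp
  then have int\<phi>: "integrable ?P \<phi>"
  proof (rule Bochner_Integration.integrable_bound)
    show "\<phi> \<in> borel_measurable ?P" by measurable
    have "norm (\<phi> z) \<le> norm (1 + \<bar>u (snd z) - u (fst z)\<bar> powr p)" for z
    proof -
      have "norm (\<phi> z) \<le> \<bar>u (snd z) - u (fst z)\<bar> powr (p - 1)"
        by (auto simp: \<phi>_def split_beta abs_mult abs_sgn_eq)
      also have "\<dots> \<le> norm (1 + \<bar>u (snd z) - u (fst z)\<bar> powr p)"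
        using bound[of "u (snd z) - u (fst z)"] by simp
      finally show ?thesis .
    qed
    then show "AE z in ?P. norm (\<phi> z) \<le> norm (1 + \<bar>u (snd z) - u (fst z)\<bar> powr p)" by simp
  qed
  define f where "f = (\<lambda>z. \<phi> z * h (u (fst z)))"
  have intf: "integrable ?P f"
    unfolding f_def
  proof (rule Bochner_Integration.integrable_bound[OF integrable_mult_right[OF int\<phi>, of K]])
    show "(\<lambda>z. \<phi> z * h (u (fst z))) \<in> borel_measurable ?P" by measurable
    show "AE z in ?P. norm (\<phi> z * h (u (fst z))) \<le> norm (K * \<phi> z)"
    proof (rule AE_I2)
      fix z :: "'a \<times> 'a"
      have "\<bar>h (u (fst z))\<bar> \<le> \<bar>K\<bar>" using h(2)[of "u (fst z)"] by linarith
      then show "norm (\<phi> z * h (u (fst z))) \<le> norm (K * \<phi> z)"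
        unfolding real_norm_def abs_mult by (metis mult.commute mult_left_mono abs_ge_zero)
    qed
  qed
  have "(\<integral>x. w x * h (u x) \<partial>\<nu>) = (\<integral>x. (\<integral>y. f (x, y) \<partial>m x) \<partial>\<nu>)"
  proof (rule Bochner_Integration.integral_cong_AE)
    have "f \<in> borel_measurable (\<nu> \<Otimes>\<^sub>M \<nu>)" unfolding f_def by measurable
    then show "(\<lambda>x. \<integral>y. f (x, y) \<partial>m x) \<in> borel_measurable \<nu>"
      by (rule integral_kernel_measurable)
    have "AE x in \<nu>. w x = (\<integral>y. \<phi> (x, y) \<partial>m x)"
      using D by (simp add: DeltaP_def \<phi>_def)
    then show "AE x in \<nu>. w x * h (u x) = (\<integral>y. f (x, y) \<partial>m x)"
      by eventually_elim (simp add: f_def)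
  qed measurable
  also have "\<dots> = (\<integral>z. f z \<partial>?P)"
    by (rule integral_edge_measure[OF intf])
  finally have eq: "(\<integral>x. w x * h (u x) \<partial>\<nu>) = (\<integral>z. f z \<partial>?P)" .
  \<comment> \<open>The integral of \<open>f\<close> need not have a signed integrand; the sum of
    \<open>f\<close> and its swap does.\<close>
  have "2 * (\<integral>z. f z \<partial>?P) = (\<integral>z. f z \<partial>?P) + (\<integral>z. f (snd z, fst z) \<partial>?P)"
    using edge_measure_swap(2)[OF intf] by simp
  also have "\<dots> = (\<integral>z. f z + f (snd z, fst z) \<partial>?P)"
    using intf edge_measure_swap(1)[OF intf] by simp
  also have "\<dots> \<le> (\<integral>z. 0 \<partial>?P)"
  proof (rule integral_mono)
    show "integrable ?P (\<lambda>z. f z + f (snd z, fst z))"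
      using intf edge_measure_swap(1)[OF intf] by simp
    show "f z + f (snd z, fst z) \<le> 0" for z
    proof -
      obtain x y where z: "z = (x, y)" by fastforce
      have "f z + f (snd z, fst z) = - (sgn (u y - u x) * (h (u y) - h (u x)) * \<bar>u y - u x\<bar> powr (p - 1))"
        by (simp add: z f_def \<phi>_def sgn_if abs_minus_commute algebra_simps)
      moreover have "0 \<le> sgn (u y - u x) * (h (u y) - h (u x))"
        using monoD[OF h(1), of "u x" "u y"] monoD[OF h(1), of "u y" "u x"] by (auto simp: sgn_if)
      ultimately show ?thesis by simp
    qed
  qed simp
  finally show ?thesis using eq by simp
qed

text \<open>Constants are monotone, and both signs are allowed as test functions.\<close>

lemma DeltaP_integral_zero:
  assumes "p > 1" "emeasure \<nu> (space \<nu>) < \<infinity>" "DeltaP \<nu> m p u w"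
  shows "(\<integral>x. w x \<partial>\<nu>) = 0"
  using DeltaP_monotone_test[OF assms, of "\<lambda>_. 1" 1] DeltaP_monotone_test[OF assms, of "\<lambda>_. -1" 1]
  by (simp add: mono_def)

text \<open>For \<open>p > 2\<close> the function \<open>u\<close> need not lie in \<open>L\<^sup>p\<close>, so that \<open>u\<close> itself is not an admissible
  test function; its truncations are.\<close>

lemma DeltaP_dissipative:
  assumes "p > 1" "emeasure \<nu> (space \<nu>) < \<infinity>" and D: "DeltaP \<nu> m p u w"
  shows "(\<integral>x. w x * u x \<partial>\<nu>) \<le> 0"
proof -
  define T where "T = (\<lambda>(k::nat) a::real. max (- real k) (min (real k) a))"
  have u: "L2 \<nu> u" and w: "L2 \<nu> w" using D by (auto simp: DeltaP_def)
  note [measurable] = u[THEN L2_measurable] w[THEN L2_measurable]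
  have "(\<lambda>k. \<integral>x. w x * T k (u x) \<partial>\<nu>) \<longlonglongrightarrow> (\<integral>x. w x * u x \<partial>\<nu>)"
  proof (rule integral_dominated_convergence)
    show "integrable \<nu> (\<lambda>x. \<bar>w x * u x\<bar>)"
      using L2_integrable_mult[OF w u] by simp
    show "AE x in \<nu>. (\<lambda>k. w x * T k (u x)) \<longlonglongrightarrow> w x * u x"
    proof (rule AE_I2)
      fix x
      obtain k0 :: nat where k0: "\<bar>u x\<bar> \<le> real k0" using real_arch_simple by blast
      have "T k (u x) = u x" if "k \<ge> k0" for k
        using that k0 by (auto simp: T_def)
      then have "\<forall>\<^sub>F k in sequentially. w x * T k (u x) = w x * u x"
        by (auto intro: eventually_sequentiallyI)
      then show "(\<lambda>k. w x * T k (u x)) \<longlonglongrightarrow> w x * u x" by (rule tendsto_eventually)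
    qed
    show "AE x in \<nu>. norm (w x * T k (u x)) \<le> \<bar>w x * u x\<bar>" for k
      by (rule AE_I2) (auto simp: abs_mult T_def intro!: mult_left_mono)
  qed (auto simp: T_def)
  moreover have "(\<integral>x. w x * T k (u x) \<partial>\<nu>) \<le> 0" for k
    by (rule DeltaP_monotone_test[OF assms, where K = "real k"]) (auto simp: T_def mono_def)
  ultimately show ?thesis by (auto intro: LIMSEQ_le_const2)
qed

end

subsection \<open>The subdifferential of the total variation energy\<close>

text \<open>The energy sees only differences, so a translation by any constant, of either sign,
  costs nothing. \<open>Delta1\<close> negates its last argument; written with \<open>- v\<close>,
  the statement has \<open>v\<close> itself in the subdifferential.\<close>

lemma Delta1_integral_zero:
  assumes "finite_measure \<nu>" and D: "Delta1 \<nu> m u (\<lambda>x. - v x)"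
  shows "(\<integral>x. v x \<partial>\<nu>) = 0"
proof -
  interpret finite_measure \<nu> by fact
  have "c * (\<integral>x. v x \<partial>\<nu>) \<le> 0" for c
  proof -
    have "F1 \<nu> m (\<lambda>x. u x + c) = F1 \<nu> m u" by (simp add: F1_def)
    moreover have "L2 \<nu> (\<lambda>x. u x + c)" using D by (intro L2_add L2_const) (simp add: Delta1_def)
    ultimately show ?thesis using D by (auto simp: Delta1_def mult.commute)
  qed
  from this[of 1] this[of "-1"] show ?thesis by simp
qed

lemma Delta1_energy_le:
  assumes "finite_measure \<nu>" and D: "Delta1 \<nu> m u (\<lambda>x. - v x)"
  shows "enn2real (F1 \<nu> m u) \<le> (\<integral>x. v x * (u x - c) \<partial>\<nu>)"
proof -
  interpret finite_measure \<nu> by fact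
  have "F1 \<nu> m (\<lambda>_. c) = 0" by (simp add: F1_def)
  then have "enn2real (F1 \<nu> m u) + (\<integral>x. v x * (c - u x) \<partial>\<nu>) \<le> 0"
    using D L2_const[of c] by (auto simp: Delta1_def)
  moreover have "(\<integral>x. v x * (c - u x) \<partial>\<nu>) = - (\<integral>x. v x * (u x - c) \<partial>\<nu>)"
    by (simp add: Bochner_Integration.integral_minus[symmetric] right_diff_distrib
        del: Bochner_Integration.integral_minus)
  ultimately show ?thesis by simp
qed

section \<open>Dissipativity of the full operator and the Poincare estimate\<close>

lemma walk_of_reversible:
  assumes rw: "random_walk_space M m \<nu>" and rev: "reversible M m \<nu>"
  shows "walk m \<nu>"
proof (rule walk.intro)
  have sets [measurable_cong]: "sets \<nu> = sets M" using rw by (simp add: random_walk_space_def)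
  then have space: "space \<nu> = space M" by (rule sets_eq_imp_space_eq)
  have prob: "prob_space (m x)" "sets (m x) = sets M" if "x \<in> space M" for x
    using rw that by (auto simp: random_walk_space_def)
  have "(\<lambda>x. emeasure (m x) A) \<in> borel_measurable \<nu>" if "A \<in> sets \<nu>" for A
    using rw that sets by (simp add: random_walk_space_def cong: measurable_cong_sets)
  then show "m \<in> measurable \<nu> (subprob_algebra \<nu>)"
    using prob by (intro measurable_subprob_algebra) (auto simp: space sets prob_space_imp_subprob_space)
  show "prob_space (m x)" if "x \<in> space \<nu>" for x using prob that space by simp
  show "(\<integral>\<^sup>+ x. (\<integral>\<^sup>+ y. f (x, y) \<partial>m x) \<partial>\<nu>) = (\<integral>\<^sup>+ x. (\<integral>\<^sup>+ y. f (y, x) \<partial>m x) \<partial>\<nu>)"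
    if "f \<in> borel_measurable (\<nu> \<Otimes>\<^sub>M \<nu>)" for f
    using rev that measurable_cong_sets[OF sets_pair_measure_cong[OF sets sets] refl]
    by (auto simp: reversible_def)
qed

lemma finite_measure_bounded_density:
  assumes "finite_measure \<nu>" and [measurable]: "\<mu> \<in> borel_measurable \<nu>"
    and bdd: "AE x in \<nu>. \<bar>\<mu> x\<bar> \<le> K"
  shows "emeasure (density \<nu> (\<lambda>x. ennreal (\<mu> x))) (space \<nu>) < \<infinity>"
proof -
  interpret finite_measure \<nu> by fact
  have "emeasure (density \<nu> (\<lambda>x. ennreal (\<mu> x))) (space \<nu>) = (\<integral>\<^sup>+ x. ennreal (\<mu> x) \<partial>\<nu>)"
    by (subst emeasure_density) (auto intro!: nn_integral_cong)
  also have "\<dots> \<le> (\<integral>\<^sup>+ x. ennreal K \<partial>\<nu>)"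
    using bdd by (intro nn_integral_mono_AE) (auto elim!: eventually_mono intro!: ennreal_leI)
  also have "\<dots> < \<infinity>"
    using emeasure_finite[of "space \<nu>"] by (simp add: ennreal_mult_eq_top_iff less_top[symmetric])
  finally show ?thesis .
qed

lemma Aop_dissipative:
  assumes p: "p > 1" and "finite_measure \<nu>1" and "walk m2 \<nu>2"
    and \<mu> [measurable]: "\<mu> \<in> borel_measurable \<nu>1" and \<nu>2: "\<nu>2 = density \<nu>1 (\<lambda>x. ennreal (\<mu> x))"
    and bdd: "AE x in \<nu>1. \<bar>\<mu> x\<bar> \<le> K" and pos: "AE x in \<nu>1. 0 \<le> \<mu> x"
    and A: "Aop \<nu>1 m1 \<nu>2 m2 \<mu> p u v"
  shows "(\<integral>x. v x \<partial>\<nu>1) = 0"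
    and "enn2real (F1 \<nu>1 m1 u) \<le> (\<integral>x. v x * (u x - C) \<partial>\<nu>1)"
    and "F1 \<nu>1 m1 u < \<infinity>"
proof -
  interpret finite_measure \<nu>1 by fact
  interpret walk m2 \<nu>2 by fact
  have fin2: "emeasure \<nu>2 (space \<nu>2) < \<infinity>"
    using finite_measure_bounded_density[OF assms(2) \<mu> bdd] by (simp add: \<nu>2)
  interpret N2: finite_measure \<nu>2
    using fin2 by (intro finite_measureI) auto
  obtain v1 w where D1: "Delta1 \<nu>1 m1 u (\<lambda>x. - v1 x)" and DP: "DeltaP \<nu>2 m2 p u w"
    and v: "AE x in \<nu>1. v x = v1 x - \<mu> x * w x"
    and L2u: "L2 \<nu>1 u" and L2v: "L2 \<nu>1 v"
    using A by (auto simp: Aop_def)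
  have L2v1: "L2 \<nu>1 v1"
    using D1 L2_cmult[of \<nu>1 "\<lambda>x. - v1 x" "-1"] by (simp add: Delta1_def)
  have u2: "L2 \<nu>2 u" and w2: "L2 \<nu>2 w" using DP by (auto simp: DeltaP_def)
  note [measurable] = L2u[THEN L2_measurable] L2v[THEN L2_measurable] L2v1[THEN L2_measurable]
  have [measurable]: "w \<in> borel_measurable \<nu>1"
    using L2_measurable[OF w2] by (simp add: \<nu>2)
  \<comment> \<open>The weight is absorbed into the measure. The sign condition on
    \<open>\<mu>\<close> enters because \<open>ennreal\<close> sends negative values to 0.\<close>
  have dens: "integrable \<nu>1 (\<lambda>x. \<mu> x * f x)" "(\<integral>x. \<mu> x * f x \<partial>\<nu>1) = (\<integral>x. f x \<partial>\<nu>2)"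
    if "integrable \<nu>2 f" for f :: "'a \<Rightarrow> real"
  proof -
    have [measurable]: "f \<in> borel_measurable \<nu>1"
      using borel_measurable_integrable[OF that] by (simp add: \<nu>2)
    show "integrable \<nu>1 (\<lambda>x. \<mu> x * f x)" "(\<integral>x. \<mu> x * f x \<partial>\<nu>1) = (\<integral>x. f x \<partial>\<nu>2)"
      using that pos unfolding \<nu>2
      by (simp_all add: integrable_real_density integral_real_density)
  qed
  have intw: "integrable \<nu>2 w" using w2 by (rule N2.L2_integrable)
  have intwu: "integrable \<nu>2 (\<lambda>x. w x * u x)" using w2 u2 by (rule L2_integrable_mult)
  have "(\<integral>x. v x \<partial>\<nu>1) = (\<integral>x. v1 x - \<mu> x * w x \<partial>\<nu>1)"
    using v by (intro integral_cong_AE) auto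
  also have "\<dots> = (\<integral>x. v1 x \<partial>\<nu>1) - (\<integral>x. w x \<partial>\<nu>2)"
    using dens[OF intw] L2_integrable[OF L2v1] by simp
  also have "\<dots> = 0"
    using Delta1_integral_zero[OF assms(2) D1] DeltaP_integral_zero[OF p fin2 DP] by simp
  finally show "(\<integral>x. v x \<partial>\<nu>1) = 0" .
  have intwuC: "integrable \<nu>2 (\<lambda>x. w x * (u x - C))"
    using intw intwu by (simp add: right_diff_distrib)
  \<comment> \<open>Shifting by C is free, since \<open>w\<close> has integral zero with respect to
    \<open>\<nu>2\<close>.\<close>
  have "(\<integral>x. w x * (u x - C) \<partial>\<nu>2) = (\<integral>x. w x * u x \<partial>\<nu>2) - (\<integral>x. w x \<partial>\<nu>2) * C"
    using intw intwu by (simp add: right_diff_distrib)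
  then have le: "(\<integral>x. w x * (u x - C) \<partial>\<nu>2) \<le> 0"
    using DeltaP_integral_zero[OF p fin2 DP] DeltaP_dissipative[OF p fin2 DP] by simp
  have "(\<integral>x. v x * (u x - C) \<partial>\<nu>1) = (\<integral>x. v1 x * (u x - C) - \<mu> x * (w x * (u x - C)) \<partial>\<nu>1)"
  proof (rule integral_cong_AE)
    show "AE x in \<nu>1. v x * (u x - C) = v1 x * (u x - C) - \<mu> x * (w x * (u x - C))"
      using v by eventually_elim (simp add: left_diff_distrib mult.assoc)
  qed measurable
  also have "\<dots> = (\<integral>x. v1 x * (u x - C) \<partial>\<nu>1) - (\<integral>x. w x * (u x - C) \<partial>\<nu>2)"
    using dens[OF intwuC] L2_integrable_mult[OF L2v1 L2_diff[OF L2u L2_const[of C]]] by simp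
  finally show "enn2real (F1 \<nu>1 m1 u) \<le> (\<integral>x. v x * (u x - C) \<partial>\<nu>1)"
    using le Delta1_energy_le[OF assms(2) D1, of C] by simp
  show "F1 \<nu>1 m1 u < \<infinity>" using D1 by (simp add: Delta1_def)
qed

text \<open>Finiteness of the energy is essential for the real-valued form, because
  \<open>enn2real\<close> maps infinity to 0.\<close>

lemma poincare_L2norm_le:
  assumes "poincare \<nu> m 2 lam" "L2 \<nu> u" "F1 \<nu> m u < \<infinity>"
  shows "lam * L2norm \<nu> (\<lambda>x. u x - mean \<nu> u) \<le> enn2real (F1 \<nu> m u)"
proof -
  have "ennreal (lam * (\<integral>x. \<bar>u x - mean \<nu> u\<bar> powr 2 \<partial>\<nu>) powr (1 / 2)) \<le> F1 \<nu> m u"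
    using assms by (simp add: poincare_def L2_def)
  also have "(\<integral>x. \<bar>u x - mean \<nu> u\<bar> powr 2 \<partial>\<nu>) powr (1 / 2) = L2norm \<nu> (\<lambda>x. u x - mean \<nu> u)"
    by (simp add: L2norm_def powr_half_sqrt)
  finally have "ennreal (lam * L2norm \<nu> (\<lambda>x. u x - mean \<nu> u)) \<le> ennreal (enn2real (F1 \<nu> m u))"
    using assms(3) by simp
  then show ?thesis by (simp add: ennreal_le_iff)
qed

subsection \<open>The energy identity for absolutely continuous curves\<close>

text \<open>The square of the integral is a double integral over a square. The diagonal cuts it into
  two triangles that contribute equally by symmetry, and it is null because \<open>L\<close> has no
  atoms. This is the chain rule for the square of a primitive, in integrated form.\<close>

lemma square_integral_eq_ordered_integral:
  fixes a :: "real \<Rightarrow> real"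
  assumes "sigma_finite_measure L" and sets [measurable_cong]: "sets L = sets borel"
    and atoms: "\<And>\<tau>. emeasure L {\<tau>} = 0" and a: "integrable L a"
  shows "(\<integral>r. a r \<partial>L)\<^sup>2 = 2 * (\<integral>\<tau>. a \<tau> * (\<integral>r. indicator {..\<tau>} r * a r \<partial>L) \<partial>L)"
proof -
  interpret sigma_finite_measure L by fact
  interpret LL: pair_sigma_finite L L ..
  note [measurable] = borel_measurable_integrable[OF a]
  have F: "integrable (L \<Otimes>\<^sub>M L) (\<lambda>(\<tau>, r). a \<tau> * a r)"
  proof (rule LL.Fubini_integrable)
    show "integrable L (\<lambda>\<tau>. \<integral>r. norm (case (\<tau>, r) of (\<tau>, r) \<Rightarrow> a \<tau> * a r) \<partial>L)"
      using a by (simp add: abs_mult)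
  qed (use a in auto)
  have F1: "integrable (L \<Otimes>\<^sub>M L) (\<lambda>(\<tau>, r). a \<tau> * (indicator {..\<tau>} r * a r))"
    by (rule Bochner_Integration.integrable_bound[OF F]) (auto simp: indicator_def split_beta)
  have F2: "integrable (L \<Otimes>\<^sub>M L) (\<lambda>(\<tau>, r). a \<tau> * (indicator {\<tau>..} r * a r))"
    by (rule Bochner_Integration.integrable_bound[OF F]) (auto simp: indicator_def split_beta)
  define X where "X = (\<integral>\<tau>. (\<integral>r. a \<tau> * (indicator {..\<tau>} r * a r) \<partial>L) \<partial>L)"
  have split: "(\<integral>r. a r \<partial>L) = (\<integral>r. indicator {..\<tau>} r * a r \<partial>L) + (\<integral>r. indicator {\<tau>..} r * a r \<partial>L)" for \<tau>
  proof -
    have int: "integrable L (\<lambda>r. indicator S r * a r)" if [measurable]: "S \<in> sets borel" for S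
      by (rule Bochner_Integration.integrable_bound[OF a]) (auto simp: indicator_def)
    have "AE r in L. r \<noteq> \<tau>"
      by (rule AE_I[of _ _ "{\<tau>}"]) (auto simp: atoms sets)
    then have "(\<integral>r. a r \<partial>L) = (\<integral>r. indicator {..\<tau>} r * a r + indicator {\<tau>..} r * a r \<partial>L)"
      by (intro integral_cong_AE) (auto simp: indicator_def elim!: eventually_mono)
    then show ?thesis by (simp add: int)
  qed
  have "(\<integral>r. a r \<partial>L)\<^sup>2 = (\<integral>\<tau>. a \<tau> * (\<integral>r. a r \<partial>L) \<partial>L)"
    by (simp add: power2_eq_square)
  also have "\<dots> = (\<integral>\<tau>. (\<integral>r. a \<tau> * (indicator {..\<tau>} r * a r) \<partial>L)
      + (\<integral>r. a \<tau> * (indicator {\<tau>..} r * a r) \<partial>L) \<partial>L)"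
  proof (intro Bochner_Integration.integral_cong refl)
    fix \<tau>
    show "a \<tau> * (\<integral>r. a r \<partial>L) = (\<integral>r. a \<tau> * (indicator {..\<tau>} r * a r) \<partial>L)
        + (\<integral>r. a \<tau> * (indicator {\<tau>..} r * a r) \<partial>L)"
      unfolding split[of \<tau>] by (simp add: distrib_left)
  qed
  also have "\<dots> = X + (\<integral>\<tau>. (\<integral>r. a \<tau> * (indicator {\<tau>..} r * a r) \<partial>L) \<partial>L)"
    unfolding X_def using LL.integrable_fst[OF F1] LL.integrable_fst[OF F2] by simp
  \<comment> \<open>After exchanging the integrals, the condition that r is at least \<tau> reads as
    \<tau> being at most r, which is the first triangle with the names swapped.\<close>
  also have "(\<integral>\<tau>. (\<integral>r. a \<tau> * (indicator {\<tau>..} r * a r) \<partial>L) \<partial>L)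
      = (\<integral>r. (\<integral>\<tau>. a \<tau> * (indicator {\<tau>..} r * a r) \<partial>L) \<partial>L)"
    by (rule LL.Fubini_integral[OF F2, symmetric])
  also have "\<dots> = X"
    unfolding X_def by (intro Bochner_Integration.integral_cong) (auto simp: indicator_def)
  finally show ?thesis by (simp add: X_def)
qed

lemma integrable_pair_snd:
  fixes k :: "'a \<Rightarrow> real"
  assumes "finite_measure L" "sigma_finite_measure \<nu>" and k: "integrable \<nu> k"
  shows "integrable (L \<Otimes>\<^sub>M \<nu>) (\<lambda>(\<tau>, x). k x)"
proof -
  interpret L: finite_measure L by fact
  interpret N: sigma_finite_measure \<nu> by fact
  interpret LN: pair_sigma_finite L \<nu> ..
  note [measurable] = borel_measurable_integrable[OF k]
  show ?thesis
    by (rule LN.Fubini_integrable) (use k in auto)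
qed

text \<open>\<open>L\<close> stands for Lebesgue measure cut down to a bounded time interval. With
  both factors finite, square integrability of \<open>g\<close> on the product also gives
  integrability there.\<close>

locale L2_curve = L: finite_measure L + N: finite_measure \<nu>
  for L :: "real measure" and \<nu> :: "'a measure" +
  fixes g :: "real \<Rightarrow> 'a \<Rightarrow> real"
  assumes sets_L [measurable_cong]: "sets L = sets borel"
    and no_atoms: "emeasure L {\<tau>} = 0"
    and g [measurable]: "(\<lambda>(\<tau>, x). g \<tau> x) \<in> borel_measurable (L \<Otimes>\<^sub>M \<nu>)"
    and g_L2: "(\<integral>\<^sup>+ \<tau>. (\<integral>\<^sup>+ x. ennreal ((g \<tau> x)\<^sup>2) \<partial>\<nu>) \<partial>L) < \<infinity>"
begin

sublocale pair_sigma_finite L \<nu> ..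

sublocale P: finite_measure "L \<Otimes>\<^sub>M \<nu>"
  by (rule finite_measure_pair_measure) unfold_locales

lemma L2_pair: "L2 (L \<Otimes>\<^sub>M \<nu>) (\<lambda>(\<tau>, x). g \<tau> x)"
proof -
  have "integrable (L \<Otimes>\<^sub>M \<nu>) (\<lambda>z. (case z of (\<tau>, x) \<Rightarrow> g \<tau> x)\<^sup>2)"
  proof (rule integrableI_nonneg)
    have "(\<integral>\<^sup>+ z. ennreal ((case z of (\<tau>, x) \<Rightarrow> g \<tau> x)\<^sup>2) \<partial>(L \<Otimes>\<^sub>M \<nu>))
        = (\<integral>\<^sup>+ \<tau>. (\<integral>\<^sup>+ x. ennreal ((g \<tau> x)\<^sup>2) \<partial>\<nu>) \<partial>L)"
      by (subst N.nn_integral_fst[symmetric]) auto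
    then show "(\<integral>\<^sup>+ z. ennreal ((case z of (\<tau>, x) \<Rightarrow> g \<tau> x)\<^sup>2) \<partial>(L \<Otimes>\<^sub>M \<nu>)) < \<infinity>"
      using g_L2 by simp
  qed auto
  then show ?thesis using g by (simp add: L2_def)
qed

lemma integrable_pair: "integrable (L \<Otimes>\<^sub>M \<nu>) (\<lambda>(\<tau>, x). g \<tau> x)"
  using L2_pair by (rule P.L2_integrable)

lemma integral_increment: "(\<integral>x. (\<integral>\<tau>. g \<tau> x \<partial>L) \<partial>\<nu>) = (\<integral>\<tau>. (\<integral>x. g \<tau> x \<partial>\<nu>) \<partial>L)"
  by (rule Fubini_integral[OF integrable_pair])

lemma g_compose [measurable (raw)]:
  assumes "a \<in> measurable N L" "b \<in> measurable N \<nu>"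
  shows "(\<lambda>z. g (a z) (b z)) \<in> borel_measurable N"
  using measurable_compose[OF measurable_Pair[OF assms] g] by simp

text \<open>For a solution, the increment of the curve from the left end of the interval up to time
  \<tau>.\<close>

definition primitive :: "real \<Rightarrow> 'a \<Rightarrow> real" where
  "primitive \<tau> x = (\<integral>r. indicator {..\<tau>} r * g r x \<partial>L)"

lemma primitive_measurable [measurable]:
  "(\<lambda>(\<tau>, x). primitive \<tau> x) \<in> borel_measurable (L \<Otimes>\<^sub>M \<nu>)"
  unfolding primitive_def indicator_def atMost_iff by measurable

lemma AE_L2_section: "AE x in \<nu>. L2 L (\<lambda>\<tau>. g \<tau> x)"
proof -
  have "integrable (L \<Otimes>\<^sub>M \<nu>) (\<lambda>(\<tau>, x). (g \<tau> x)\<^sup>2)"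
    using L2_integrable_sq[OF L2_pair] by (simp add: case_prod_beta')
  from AE_integrable_snd[OF this] show ?thesis
    using AE_space by eventually_elim (simp add: L2_def)
qed

text \<open>Cauchy-Schwarz against an indicator. The bound is uniform in \<tau>, which yields a
  dominating function of x alone and so square integrability of \<open>primitive\<close> on the
  product.\<close>

lemma primitive_sq_le:
  assumes "L2 L (\<lambda>\<tau>. g \<tau> x)"
  shows "(primitive \<tau> x)\<^sup>2 \<le> measure L (space L) * (\<integral>r. (g r x)\<^sup>2 \<partial>L)"
proof -
  have ind: "L2 L (indicator {..\<tau>})"
    by (auto simp: L2_def sets_L power2_eq_square indicator_inter_arith[symmetric]
        L.emeasure_finite less_top[symmetric])
  have "\<bar>primitive \<tau> x\<bar> \<le> L2norm L (indicator {..\<tau>}) * L2norm L (\<lambda>r. g r x)"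
    unfolding primitive_def using L2_Cauchy_Schwarz[OF ind assms] by simp
  then have "\<bar>primitive \<tau> x\<bar>\<^sup>2 \<le> (L2norm L (indicator {..\<tau>}) * L2norm L (\<lambda>r. g r x))\<^sup>2"
    by (intro power_mono) auto
  then have "(primitive \<tau> x)\<^sup>2 \<le> (\<integral>r. (indicator {..\<tau>} r :: real)\<^sup>2 \<partial>L) * (\<integral>r. (g r x)\<^sup>2 \<partial>L)"
    by (simp add: power_mult_distrib L2norm_sq)
  also have "\<dots> \<le> measure L (space L) * (\<integral>r. (g r x)\<^sup>2 \<partial>L)"
  proof (rule mult_right_mono)
    have "(\<integral>r. (indicator {..\<tau>} r :: real)\<^sup>2 \<partial>L) \<le> (\<integral>r. 1 \<partial>L)"
      using L2_integrable_sq[OF ind] by (intro integral_mono) (auto simp: indicator_def)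
    then show "(\<integral>r. (indicator {..\<tau>} r :: real)\<^sup>2 \<partial>L) \<le> measure L (space L)" by simp
  qed simp
  finally show ?thesis .
qed

lemma integrable_primitive_sq: "integrable (L \<Otimes>\<^sub>M \<nu>) (\<lambda>(\<tau>, x). (primitive \<tau> x)\<^sup>2)"
proof -
  have "integrable \<nu> (\<lambda>x. \<integral>r. (g r x)\<^sup>2 \<partial>L)"
    using integrable_snd[of "\<lambda>\<tau> x. (g \<tau> x)\<^sup>2"] L2_integrable_sq[OF L2_pair] by (simp add: case_prod_beta')
  then have "integrable \<nu> (\<lambda>x. measure L (space L) * (\<integral>r. (g r x)\<^sup>2 \<partial>L))" by simp
  from integrable_pair_snd[OF L.finite_measure_axioms N.sigma_finite_measure_axioms this]
  show ?thesis
  proof (rule Bochner_Integration.integrable_bound)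
    show "(\<lambda>(\<tau>, x). (primitive \<tau> x)\<^sup>2) \<in> borel_measurable (L \<Otimes>\<^sub>M \<nu>)" by measurable
    show "AE z in L \<Otimes>\<^sub>M \<nu>. norm (case z of (\<tau>, x) \<Rightarrow> (primitive \<tau> x)\<^sup>2)
        \<le> norm (case z of (\<tau>, x) \<Rightarrow> measure L (space L) * (\<integral>r. (g r x)\<^sup>2 \<partial>L))"
    proof (rule AE_pair_measure)
      show "{z \<in> space (L \<Otimes>\<^sub>M \<nu>). norm (case z of (\<tau>, x) \<Rightarrow> (primitive \<tau> x)\<^sup>2)
        \<le> norm (case z of (\<tau>, x) \<Rightarrow> measure L (space L) * (\<integral>r. (g r x)\<^sup>2 \<partial>L))} \<in> sets (L \<Otimes>\<^sub>M \<nu>)"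
        by measurable
      show "AE \<tau> in L. AE x in \<nu>. norm (case (\<tau>, x) of (\<tau>, x) \<Rightarrow> (primitive \<tau> x)\<^sup>2)
        \<le> norm (case (\<tau>, x) of (\<tau>, x) \<Rightarrow> measure L (space L) * (\<integral>r. (g r x)\<^sup>2 \<partial>L))"
      proof (rule AE_I2)
        fix \<tau>
        show "AE x in \<nu>. norm (case (\<tau>, x) of (\<tau>, x) \<Rightarrow> (primitive \<tau> x)\<^sup>2)
          \<le> norm (case (\<tau>, x) of (\<tau>, x) \<Rightarrow> measure L (space L) * (\<integral>r. (g r x)\<^sup>2 \<partial>L))"
          using AE_L2_section by eventually_elim (simp add: primitive_sq_le)
      qed
    qed
  qed
qed

text \<open>Integrating the scalar identity \<open>(f + G)\<^sup>2 - f\<^sup>2 = 2 \<integral> g (f + primitive)\<close>, with \<open>G\<close> the full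
  integral of \<open>g\<close>, over the space variable replaces the chain rule for Bochner integrals.\<close>

lemma energy_identity:
  assumes f: "L2 \<nu> f" and V: "L2 \<nu> V" and V_eq: "AE x in \<nu>. V x = f x + (\<integral>\<tau>. g \<tau> x \<partial>L)"
  shows "integrable L (\<lambda>\<tau>. \<integral>x. g \<tau> x * (f x + primitive \<tau> x) \<partial>\<nu>)"
    and "(\<integral>x. (V x)\<^sup>2 \<partial>\<nu>) - (\<integral>x. (f x)\<^sup>2 \<partial>\<nu>) = 2 * (\<integral>\<tau>. (\<integral>x. g \<tau> x * (f x + primitive \<tau> x) \<partial>\<nu>) \<partial>L)"
proof -
  note [measurable] = f[THEN L2_measurable] V[THEN L2_measurable]
  have f2: "L2 (L \<Otimes>\<^sub>M \<nu>) (\<lambda>(\<tau>, x). f x)"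
    using integrable_pair_snd[OF L.finite_measure_axioms N.sigma_finite_measure_axioms L2_integrable_sq[OF f]]
    by (simp add: L2_def case_prod_beta')
  have p2: "L2 (L \<Otimes>\<^sub>M \<nu>) (\<lambda>(\<tau>, x). primitive \<tau> x)"
    using integrable_primitive_sq by (simp add: L2_def case_prod_beta')
  \<comment> \<open>A product of two square-integrable functions on the product space; its
    integrability justifies the exchange of integrals and the sections used below.\<close>
  have H: "integrable (L \<Otimes>\<^sub>M \<nu>) (\<lambda>(\<tau>, x). g \<tau> x * (f x + primitive \<tau> x))"
    using L2_integrable_mult[OF L2_pair L2_add[OF f2 p2]] by (simp add: case_prod_beta')
  show "integrable L (\<lambda>\<tau>. \<integral>x. g \<tau> x * (f x + primitive \<tau> x) \<partial>\<nu>)"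
    by (rule integrable_fst[OF H])
  have pointwise: "AE x in \<nu>. (V x)\<^sup>2 - (f x)\<^sup>2 = 2 * (\<integral>\<tau>. g \<tau> x * (f x + primitive \<tau> x) \<partial>L)"
    using AE_integrable_snd[OF H] AE_integrable_snd[OF integrable_pair] V_eq
  proof eventually_elim
    case (elim x)
    define G where "G = (\<integral>\<tau>. g \<tau> x \<partial>L)"
    have gf: "integrable L (\<lambda>\<tau>. g \<tau> x * f x)" using elim(2) by simp
    have "integrable L (\<lambda>\<tau>. g \<tau> x * (f x + primitive \<tau> x) - g \<tau> x * f x)"
      using elim(1) gf by (rule Bochner_Integration.integrable_diff)
    then have gp: "integrable L (\<lambda>\<tau>. g \<tau> x * primitive \<tau> x)"
      by (simp add: distrib_left)
    have "(V x)\<^sup>2 - (f x)\<^sup>2 = 2 * (G * f x) + G\<^sup>2"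
      using elim(3) by (simp add: G_def power2_eq_square algebra_simps)
    also have "G\<^sup>2 = 2 * (\<integral>\<tau>. g \<tau> x * primitive \<tau> x \<partial>L)"
      unfolding G_def primitive_def
      by (rule square_integral_eq_ordered_integral[OF L.sigma_finite_measure_axioms sets_L no_atoms elim(2)])
    also have "G * f x = (\<integral>\<tau>. g \<tau> x * f x \<partial>L)" by (simp add: G_def)
    finally show ?case using gf gp by (simp add: distrib_left)
  qed
  have "(\<integral>x. (V x)\<^sup>2 \<partial>\<nu>) - (\<integral>x. (f x)\<^sup>2 \<partial>\<nu>) = (\<integral>x. (V x)\<^sup>2 - (f x)\<^sup>2 \<partial>\<nu>)"
    using L2_integrable_sq[OF V] L2_integrable_sq[OF f] by simp
  also have "\<dots> = (\<integral>x. 2 * (\<integral>\<tau>. g \<tau> x * (f x + primitive \<tau> x) \<partial>L) \<partial>\<nu>)"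
    using pointwise borel_measurable_integrable[OF integrable_snd[OF H]]
    by (intro integral_cong_AE) auto
  also have "\<dots> = 2 * (\<integral>\<tau>. (\<integral>x. g \<tau> x * (f x + primitive \<tau> x) \<partial>\<nu>) \<partial>L)"
    by (simp add: Fubini_integral[OF H])
  finally show "(\<integral>x. (V x)\<^sup>2 \<partial>\<nu>) - (\<integral>x. (f x)\<^sup>2 \<partial>\<nu>)
      = 2 * (\<integral>\<tau>. (\<integral>x. g \<tau> x * (f x + primitive \<tau> x) \<partial>\<nu>) \<partial>L)" .
qed

end

subsection \<open>Decay along a dissipative curve\<close>

text \<open>A density rather than a restriction of the space: the carrier stays the whole line with
  the Borel sets, as \<open>L2_curve\<close> requires.\<close>

definition window :: "real \<Rightarrow> real \<Rightarrow> real measure" where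
  "window s t = density lborel (indicator {s..t})"

lemma sets_window [simp, measurable_cong]: "sets (window s t) = sets borel"
  by (simp add: window_def)

lemma space_window [simp]: "space (window s t) = UNIV"
  by (simp add: window_def)

lemma emeasure_window: "s \<le> t \<Longrightarrow> emeasure (window s t) UNIV = ennreal (t - s)"
  by (simp add: window_def emeasure_density)

lemma measure_window: "s \<le> t \<Longrightarrow> measure (window s t) UNIV = t - s"
  by (simp add: measure_def emeasure_window)

lemma AE_window: "AE \<tau> in lborel. s \<le> \<tau> \<longrightarrow> \<tau> \<le> t \<longrightarrow> Q \<tau> \<Longrightarrow> AE \<tau> in window s t. Q \<tau>"
  unfolding window_def by (subst AE_density) (auto elim!: eventually_mono simp: indicator_def)

lemma integral_window:
  fixes f :: "real \<Rightarrow> real"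
  assumes "f \<in> borel_measurable borel"
  shows "(\<integral>r. f r \<partial>window s t) = (\<integral>r. indicator {s..t} r * f r \<partial>lborel)"
  using integral_real_density[of "indicator {s..t}" lborel f] assms
  by (simp add: window_def ennreal_indicator)

text \<open>Of the operator only the zero integral of \<open>g\<close> is recorded. The dissipation
  inequality is a hypothesis of \<open>quadratic_decay\<close> instead, since deriving it needs the
  conservation of mass proved inside this locale.\<close>

locale L2_evolution = finite_measure \<nu> for \<nu> :: "'a measure" +
  fixes u g :: "real \<Rightarrow> 'a \<Rightarrow> real"
  assumes u_L2: "0 < t \<Longrightarrow> L2 \<nu> (u t)"
    and g_measurable: "(\<lambda>(t, x). g t x) \<in> borel_measurable (lborel \<Otimes>\<^sub>M \<nu>)"
    and g_loc_L2: "0 < a \<Longrightarrow> a < b \<Longrightarrow>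
      (\<integral>\<^sup>+ t. indicator {a..b} t * (\<integral>\<^sup>+ x. ennreal ((g t x)\<^sup>2) \<partial>\<nu>) \<partial>lborel) < \<infinity>"
    and increment: "0 < s \<Longrightarrow> s \<le> t \<Longrightarrow>
      AE x in \<nu>. u t x - u s x = (LINT \<tau>:{s..t}|lborel. g \<tau> x)"
    and conservative: "AE t in lborel. 0 < t \<longrightarrow> (\<integral>x. g t x \<partial>\<nu>) = 0"
begin

lemma L2_curve_window:
  assumes st: "0 < s" "s < t"
  shows "L2_curve (window s t) \<nu> g"
proof -
  interpret W: finite_measure "window s t"
    using st by (intro finite_measureI) (simp add: emeasure_window)
  show ?thesis
  proof
    show "sets (window s t) = sets borel" by simp
    show "emeasure (window s t) {\<tau>} = 0" for \<tau>
    proof -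
      have "emeasure (window s t) {\<tau>} = (\<integral>\<^sup>+ x. indicator {s..t} x * indicator {\<tau>} x \<partial>lborel)"
        by (simp add: window_def emeasure_density)
      also have "\<dots> \<le> (\<integral>\<^sup>+ x. indicator {\<tau>} x \<partial>lborel)"
        by (intro nn_integral_mono) (auto simp: indicator_def)
      finally show ?thesis by simp
    qed
    have "sets (window s t \<Otimes>\<^sub>M \<nu>) = sets (lborel \<Otimes>\<^sub>M \<nu>)"
      by (intro sets_pair_measure_cong) auto
    then show "(\<lambda>(\<tau>, x). g \<tau> x) \<in> borel_measurable (window s t \<Otimes>\<^sub>M \<nu>)"
      using g_measurable by (simp cong: measurable_cong_sets)
    note [measurable] = g_measurable
    have "(\<integral>\<^sup>+ \<tau>. (\<integral>\<^sup>+ x. ennreal ((g \<tau> x)\<^sup>2) \<partial>\<nu>) \<partial>window s t)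
        = (\<integral>\<^sup>+ \<tau>. indicator {s..t} \<tau> * (\<integral>\<^sup>+ x. ennreal ((g \<tau> x)\<^sup>2) \<partial>\<nu>) \<partial>lborel)"
      unfolding window_def by (rule nn_integral_density) measurable
    then show "(\<integral>\<^sup>+ \<tau>. (\<integral>\<^sup>+ x. ennreal ((g \<tau> x)\<^sup>2) \<partial>\<nu>) \<partial>window s t) < \<infinity>"
      using g_loc_L2[OF st] by simp
  qed
qed

lemma g_section: "x \<in> space \<nu> \<Longrightarrow> (\<lambda>\<tau>. g \<tau> x) \<in> borel_measurable borel"
  using measurable_Pair1[OF g_measurable, of x] by simp

lemma increment_window:
  assumes "0 < s" "s \<le> t"
  shows "AE x in \<nu>. u t x = u s x + (\<integral>\<tau>. g \<tau> x \<partial>window s t)"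
  using increment[OF assms] AE_space
  by eventually_elim (simp add: integral_window g_section set_lebesgue_integral_def)

text \<open>The exceptional null set may depend on \<tau>; this is harmless, as the identity is used
  under an integral over x at fixed \<tau>.\<close>

lemma increment_primitive:
  assumes "0 < s" "s < t" "s \<le> \<tau>" "\<tau> \<le> t"
  shows "AE x in \<nu>. u \<tau> x = u s x + L2_curve.primitive (window s t) g \<tau> x"
  using increment[OF assms(1,3)] AE_space
proof eventually_elim
  case (elim x)
  have [measurable]: "(\<lambda>\<tau>. g \<tau> x) \<in> borel_measurable borel" using elim by (simp add: g_section)
  have "L2_curve.primitive (window s t) g \<tau> x = (\<integral>r. indicator {s..t} r * (indicator {..\<tau>} r * g r x) \<partial>lborel)"
    unfolding L2_curve.primitive_def[OF L2_curve_window[OF assms(1,2)]] by (simp add: integral_window)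
  also have "\<dots> = (LINT r:{s..\<tau>}|lborel. g r x)"
    unfolding set_lebesgue_integral_def using assms
    by (intro Bochner_Integration.integral_cong) (auto simp: indicator_def)
  finally show ?case using elim by simp
qed

lemma mass_conservation:
  assumes st: "0 < s" "s \<le> t"
  shows "(\<integral>x. u t x \<partial>\<nu>) = (\<integral>x. u s x \<partial>\<nu>)"
proof (cases "s = t")
  case False
  then interpret L2_curve "window s t" \<nu> g using st by (intro L2_curve_window) auto
  have us: "integrable \<nu> (u s)" and ut: "integrable \<nu> (u t)"
    using st by (auto intro!: L2_integrable u_L2)
  have int: "integrable \<nu> (\<lambda>x. \<integral>\<tau>. g \<tau> x \<partial>window s t)"
    by (rule integrable_snd[OF integrable_pair])
  have "AE \<tau> in window s t. (\<integral>x. g \<tau> x \<partial>\<nu>) = 0"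
    using conservative st by (intro AE_window) (auto elim!: eventually_mono)
  then have "(\<integral>\<tau>. (\<integral>x. g \<tau> x \<partial>\<nu>) \<partial>window s t) = 0"
    by (rule integral_eq_zero_AE)
  then have "(\<integral>x. (\<integral>\<tau>. g \<tau> x \<partial>window s t) \<partial>\<nu>) = 0" by (simp add: integral_increment)
  moreover have "(\<integral>x. u t x \<partial>\<nu>) = (\<integral>x. u s x + (\<integral>\<tau>. g \<tau> x \<partial>window s t) \<partial>\<nu>)"
    using increment_window[OF st] us ut int by (intro integral_cong_AE) auto
  ultimately show ?thesis using us int by simp
qed simp

lemma quadratic_decay:
  assumes st: "0 < s" "s \<le> t" and lam: "lam > 0"
    and diss: "AE \<tau> in lborel. 0 < \<tau> \<longrightarrow> g \<tau> \<in> borel_measurable \<nu> \<and>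
      (\<integral>x. g \<tau> x * (u \<tau> x - C) \<partial>\<nu>) \<le> - (lam * L2norm \<nu> (\<lambda>x. u \<tau> x - C))"
  defines "y \<equiv> \<lambda>r. L2norm \<nu> (\<lambda>x. u r x - C)"
  shows "(y t)\<^sup>2 + 2 * lam * (t - s) * y t \<le> (y s)\<^sup>2"
proof -
  have uC: "L2 \<nu> (\<lambda>x. u r x - C)" if "0 < r" for r
    using that by (intro L2_diff u_L2 L2_const)
  \<comment> \<open>The free bound \<open>e\<close> allows two uses: \<open>e = 0\<close> shows that
    y decreases, and this monotonicity then admits \<open>e = lam * y t\<close> on the whole
    interval.\<close>
  have step: "(y b)\<^sup>2 - (y a)\<^sup>2 \<le> - (2 * (b - a) * e)"
    if ab: "0 < a" "a < b" and e: "\<And>r. a \<le> r \<Longrightarrow> r \<le> b \<Longrightarrow> e \<le> lam * y r" for a b e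
  proof -
    interpret L2_curve "window a b" \<nu> g using ab by (rule L2_curve_window)
    \<comment> \<open>The integrand of the energy identity. For almost every \<tau> of the window it
      is the pairing of \<open>g \<tau>\<close> with \<open>u \<tau> - C\<close>, to which the
      dissipation hypothesis applies.\<close>
    define D where "D = (\<lambda>\<tau>. \<integral>x. g \<tau> x * (u a x - C + primitive \<tau> x) \<partial>\<nu>)"
    have V: "AE x in \<nu>. u b x - C = u a x - C + (\<integral>\<tau>. g \<tau> x \<partial>window a b)"
      using increment_window[of a b] ab by (auto elim!: eventually_mono)
    have "0 < b" using ab by simp
    note id = energy_identity[OF uC[OF ab(1)] uC[OF \<open>0 < b\<close>] V]
    have "AE \<tau> in window a b. D \<tau> \<le> - e"
    proof (rule AE_window)
      show "AE \<tau> in lborel. a \<le> \<tau> \<longrightarrow> \<tau> \<le> b \<longrightarrow> D \<tau> \<le> - e"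
        using diss
      proof eventually_elim
        case (elim \<tau>)
        show ?case
        proof (intro impI)
          assume \<tau>: "a \<le> \<tau>" "\<tau> \<le> b"
          then have [measurable]: "g \<tau> \<in> borel_measurable \<nu>" using elim ab by auto
          have [measurable]: "u a \<in> borel_measurable \<nu>" "u \<tau> \<in> borel_measurable \<nu>"
            using \<tau> ab by (auto intro!: L2_measurable u_L2)
          have [measurable]: "(\<lambda>x. primitive \<tau> x) \<in> borel_measurable \<nu>"
            using measurable_Pair2[OF primitive_measurable, of \<tau>] by simp
          have "D \<tau> = (\<integral>x. g \<tau> x * (u \<tau> x - C) \<partial>\<nu>)"
            unfolding D_def
          proof (rule integral_cong_AE)
            show "AE x in \<nu>. g \<tau> x * (u a x - C + primitive \<tau> x) = g \<tau> x * (u \<tau> x - C)"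
              using increment_primitive[OF ab \<tau>] by (auto elim!: eventually_mono)
          qed measurable
          also have "\<dots> \<le> - (lam * y \<tau>)" using elim \<tau> ab by (simp add: y_def)
          also have "\<dots> \<le> - e" using e[OF \<tau>] by simp
          finally show "D \<tau> \<le> - e" .
        qed
      qed
    qed
    then have "(\<integral>\<tau>. D \<tau> \<partial>window a b) \<le> (\<integral>\<tau>. - e \<partial>window a b)"
      using id(1) by (intro integral_mono_AE) (auto simp: D_def)
    then have "(\<integral>\<tau>. D \<tau> \<partial>window a b) \<le> - ((b - a) * e)"
      using ab by (simp add: measure_window)
    moreover have "(y b)\<^sup>2 - (y a)\<^sup>2 = 2 * (\<integral>\<tau>. D \<tau> \<partial>window a b)"
      using id(2) by (simp add: y_def L2norm_sq D_def)
    ultimately show ?thesis by (simp only: mult.assoc)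
  qed
  have y0: "0 \<le> y r" for r by (simp add: y_def L2norm_nonneg)
  have mono: "y t \<le> y r" if "s \<le> r" "r \<le> t" for r
  proof (cases "r = t")
    case False
    then have "(y t)\<^sup>2 - (y r)\<^sup>2 \<le> - (2 * (t - r) * 0)"
      using that st less_imp_le[OF lam] y0 by (intro step mult_nonneg_nonneg) linarith+
    then show ?thesis using y0[of r] power2_le_imp_le[of "y t" "y r"] by simp
  qed simp
  show ?thesis
  proof (cases "s = t")
    case False
    then have "(y t)\<^sup>2 - (y s)\<^sup>2 \<le> - (2 * (t - s) * (lam * y t))"
      using st lam mono by (intro step mult_left_mono) auto
    then show ?thesis by (simp add: mult_ac)
  qed simp
qed

end

subsection \<open>Finite-time extinction\<close>

theorem theorem3p5:
  fixes M \<nu>1 \<nu>2 :: "'a measure" and m1 m2 :: "'a \<Rightarrow> 'a measure"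
    and \<mu> :: "'a \<Rightarrow> real" and p c lam :: real
    and u0 :: "'a \<Rightarrow> real" and u :: "real \<Rightarrow> 'a \<Rightarrow> real"
  assumes "p > 1"
    and "random_walk_space M m1 \<nu>1" and "reversible M m1 \<nu>1"
    and "random_walk_space M m2 \<nu>2" and "reversible M m2 \<nu>2"
    and "absolutely_continuous \<nu>1 \<nu>2"
    and "\<mu> \<in> borel_measurable M" and "\<nu>2 = density \<nu>1 (\<lambda>x. ennreal (\<mu> x))"
    and "\<exists>K. AE x in \<nu>1. \<bar>\<mu> x\<bar> \<le> K"
    and "c > 0" and "AE x in \<nu>1. \<mu> x \<ge> c"
    and "emeasure \<nu>1 (space M) < \<infinity>"
    and "poincare \<nu>1 m1 2 lam"
    and "L2 \<nu>1 u0"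
    and "strong_solution \<nu>1 m1 \<nu>2 m2 \<mu> p u0 u"
  shows "(\<forall>t>0. L2norm \<nu>1 (\<lambda>x. u t x - mean \<nu>1 u0)
                \<le> max 0 (L2norm \<nu>1 (\<lambda>x. u0 x - mean \<nu>1 u0) - lam * t))
       \<and> Inf {T. T > 0 \<and> (\<forall>t\<ge>T. AE x in \<nu>1. u t x = mean \<nu>1 u0)}
           \<le> L2norm \<nu>1 (\<lambda>x. u0 x - mean \<nu>1 u0) / lam"
proof -
  note p = assms(1) and rw1 = assms(2) and \<nu>2 = assms(8) and u0 = assms(14) and sol = assms(15)
  have sets1: "sets \<nu>1 = sets M" using rw1 by (simp add: random_walk_space_def)
  interpret finite_measure \<nu>1
    using assms(12) sets_eq_imp_space_eq[OF sets1] by (intro finite_measureI) auto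
  have \<mu>: "\<mu> \<in> borel_measurable \<nu>1"
    using assms(7) measurable_cong_sets[OF sets1 refl] by blast
  have \<mu>0: "AE x in \<nu>1. 0 \<le> \<mu> x" using assms(10,11) by (auto elim!: eventually_mono)
  obtain K where K: "AE x in \<nu>1. \<bar>\<mu> x\<bar> \<le> K" using assms(9) by blast
  have walk2: "walk m2 \<nu>2" using assms(4,5) by (rule walk_of_reversible)
  have lam: "lam > 0" using assms(13) by (simp add: poincare_def)
  have uL2: "L2 \<nu>1 (u t)" if "0 \<le> t" for t using sol that by (simp add: strong_solution_def)
  have cont: "((\<lambda>s. L2norm \<nu>1 (\<lambda>x. u s x - u 0 x)) \<longlongrightarrow> 0) (at 0 within {0..})"
    using sol by (simp add: strong_solution_def)
  have init: "AE x in \<nu>1. u 0 x = u0 x" using sol by (simp add: strong_solution_def)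
  obtain g where g: "(\<lambda>(t, x). g t x) \<in> borel_measurable (lborel \<Otimes>\<^sub>M \<nu>1)"
    "\<And>a b. 0 < a \<Longrightarrow> a < b \<Longrightarrow>
      (\<integral>\<^sup>+ t. indicator {a..b} t * (\<integral>\<^sup>+ x. ennreal ((g t x)\<^sup>2) \<partial>\<nu>1) \<partial>lborel) < \<infinity>"
    "\<And>s t. 0 < s \<Longrightarrow> s \<le> t \<Longrightarrow> AE x in \<nu>1. u t x - u s x = (LINT \<tau>:{s..t}|lborel. g \<tau> x)"
    "AE t in lborel. 0 < t \<longrightarrow> Aop \<nu>1 m1 \<nu>2 m2 \<mu> p (u t) (\<lambda>x. - g t x)"
    using sol unfolding strong_solution_def by blast
  note Aop = Aop_dissipative[OF p finite_measure_axioms walk2 \<mu> \<nu>2 K \<mu>0]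
  interpret L2_evolution \<nu>1 u g
  proof
    show "AE t in lborel. 0 < t \<longrightarrow> (\<integral>x. g t x \<partial>\<nu>1) = 0"
      using g(4) by eventually_elim (auto dest: Aop(1))
  qed (use uL2 g in auto)

  define C where "C = mean \<nu>1 u0"
  define y where "y = (\<lambda>r. L2norm \<nu>1 (\<lambda>x. u r x - C))"
  have uC: "L2 \<nu>1 (\<lambda>x. u r x - C)" if "0 \<le> r" for r
    using that by (intro L2_diff uL2 L2_const)
  have at0: "((\<lambda>s. L2norm \<nu>1 (\<lambda>x. u s x - u 0 x)) \<longlongrightarrow> 0) (at_right 0)"
    using cont by (rule tendsto_within_subset) auto
  have ev: "\<forall>\<^sub>F s in at_right 0. 0 < s \<and> s \<le> t" if "0 < t" for t :: real
    using eventually_at_right_less[of "0::real"] eventually_at_right_real[OF that]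
    by eventually_elim auto

  \<comment> \<open>Conservation holds between positive times. On a finite measure, L2 convergence
    implies convergence of integrals, by Cauchy-Schwarz against 1, so the conserved value is that of
    the initial datum.\<close>
  have mean_eq: "mean \<nu>1 (u t) = C" if "0 < t" for t
  proof -
    have "(\<integral>x. u t x \<partial>\<nu>1) = (\<integral>x. u 0 x \<partial>\<nu>1)"
    proof (rule tendsto_unique)
      have "\<forall>\<^sub>F s in at_right 0. (\<integral>x. u s x \<partial>\<nu>1) = (\<integral>x. u t x \<partial>\<nu>1)"
        using ev[OF that] by eventually_elim (auto intro: mass_conservation[symmetric])
      then show "((\<lambda>s. \<integral>x. u s x \<partial>\<nu>1) \<longlongrightarrow> (\<integral>x. u t x \<partial>\<nu>1)) (at_right 0)"
        by (rule tendsto_eventually)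
      have "((\<lambda>s. L2norm \<nu>1 (\<lambda>x. u s x - u 0 x) * L2norm \<nu>1 (\<lambda>_. 1)) \<longlongrightarrow> 0 * L2norm \<nu>1 (\<lambda>_. 1)) (at_right 0)"
        by (intro tendsto_intros at0)
      moreover have "\<forall>\<^sub>F s in at_right 0. norm ((\<integral>x. u s x \<partial>\<nu>1) - (\<integral>x. u 0 x \<partial>\<nu>1))
          \<le> L2norm \<nu>1 (\<lambda>x. u s x - u 0 x) * L2norm \<nu>1 (\<lambda>_. 1)"
        using ev[OF that]
      proof eventually_elim
        case (elim s)
        then show ?case
          using L2_Cauchy_Schwarz[OF L2_diff[OF uL2[of s] uL2[of 0]] L2_const[of 1]]
            L2_integrable[OF uL2[of s]] L2_integrable[OF uL2[of 0]] by simp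
      qed
      ultimately have "((\<lambda>s. (\<integral>x. u s x \<partial>\<nu>1) - (\<integral>x. u 0 x \<partial>\<nu>1)) \<longlongrightarrow> 0) (at_right 0)"
        by (auto intro: Lim_null_comparison)
      then show "((\<lambda>s. \<integral>x. u s x \<partial>\<nu>1) \<longlongrightarrow> (\<integral>x. u 0 x \<partial>\<nu>1)) (at_right 0)"
        by (simp add: LIM_zero_iff)
    qed simp
    also have "\<dots> = (\<integral>x. u0 x \<partial>\<nu>1)"
      using init uL2[of 0] u0 by (intro integral_cong_AE) (auto intro: L2_measurable)
    finally show ?thesis by (simp add: C_def mean_def)
  qed

  \<comment> \<open>By \<open>mean_eq\<close> the centre in the Poincare inequality is the fixed
    constant \<open>C\<close>. The sign comes from \<open>- g \<tau>\<close> being the element of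
    the operator.\<close>
  have diss: "AE \<tau> in lborel. 0 < \<tau> \<longrightarrow> g \<tau> \<in> borel_measurable \<nu>1 \<and>
      (\<integral>x. g \<tau> x * (u \<tau> x - C) \<partial>\<nu>1) \<le> - (lam * L2norm \<nu>1 (\<lambda>x. u \<tau> x - C))"
    using g(4)
  proof eventually_elim
    case (elim \<tau>)
    show ?case
    proof
      assume \<tau>: "0 < \<tau>"
      with elim have A: "Aop \<nu>1 m1 \<nu>2 m2 \<mu> p (u \<tau>) (\<lambda>x. - g \<tau> x)" by simp
      have "lam * L2norm \<nu>1 (\<lambda>x. u \<tau> x - C) \<le> enn2real (F1 \<nu>1 m1 (u \<tau>))"
        using poincare_L2norm_le[OF assms(13) uL2[of \<tau>] Aop(3)[OF A]] \<tau> mean_eq[OF \<tau>] by simp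
      then have "(\<integral>x. g \<tau> x * (u \<tau> x - C) \<partial>\<nu>1) \<le> - (lam * L2norm \<nu>1 (\<lambda>x. u \<tau> x - C))"
        using Aop(2)[OF A, of C] by simp
      moreover have "(\<lambda>x. - (- g \<tau> x)) \<in> borel_measurable \<nu>1"
        using A by (intro borel_measurable_uminus) (simp add: Aop_def L2_def)
      ultimately show "g \<tau> \<in> borel_measurable \<nu>1 \<and>
          (\<integral>x. g \<tau> x * (u \<tau> x - C) \<partial>\<nu>1) \<le> - (lam * L2norm \<nu>1 (\<lambda>x. u \<tau> x - C))" by simp
    qed
  qed

  have y0: "0 \<le> y r" for r by (simp add: y_def L2norm_nonneg)
  have decay: "y t \<le> max 0 (y s - lam * (t - s))" if "0 < s" "s \<le> t" for s t
    using lam that(2) y0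
  proof (rule linear_decay_of_quadratic_decay)
    fix a b assume "s \<le> a" "a \<le> b" "b \<le> t"
    then show "(y b)\<^sup>2 + 2 * lam * (b - a) * y b \<le> (y a)\<^sup>2"
      unfolding y_def using that by (intro quadratic_decay lam diss) auto
  qed
  have lim: "(y \<longlongrightarrow> y 0) (at_right 0)"
  proof -
    have "\<forall>\<^sub>F s in at_right 0. norm (y s - y 0) \<le> L2norm \<nu>1 (\<lambda>x. u s x - u 0 x)"
      using ev[of 1, simplified]
    proof eventually_elim
      case (elim s)
      then show ?case
        using abs_L2norm_diff_le[OF uC[of s] uC[of 0]] by (simp add: y_def)
    qed
    then have "((\<lambda>s. y s - y 0) \<longlongrightarrow> 0) (at_right 0)"
      using at0 by (rule Lim_null_comparison)
    then show ?thesis by (simp add: LIM_zero_iff)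
  qed
  have y_init: "y 0 = L2norm \<nu>1 (\<lambda>x. u0 x - C)"
    unfolding y_def using init uC[of 0] L2_diff[OF u0 L2_const[of C]]
    by (intro L2norm_cong_AE) (auto intro: L2_measurable elim!: eventually_mono)
  \<comment> \<open>The estimate on [s, t] with positive s passes to the limit as s tends to 0 from
    the right.\<close>
  have main: "y t \<le> max 0 (y 0 - lam * t)" if "0 < t" for t
  proof (rule tendsto_lowerbound)
    have "((\<lambda>s. max 0 (y s - lam * (t - s))) \<longlongrightarrow> max 0 (y 0 - lam * (t - 0))) (at_right 0)"
      by (intro tendsto_intros lim)
    then show "((\<lambda>s. max 0 (y s - lam * (t - s))) \<longlongrightarrow> max 0 (y 0 - lam * t)) (at_right 0)" by simp
    show "\<forall>\<^sub>F s in at_right 0. y t \<le> max 0 (y s - lam * (t - s))"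
      using ev[OF that] by eventually_elim (rule decay, auto)
  qed simp

  define S where "S = {T. T > 0 \<and> (\<forall>t\<ge>T. AE x in \<nu>1. u t x = C)}"
  have "Inf S \<le> y 0 / lam"
  \<comment> \<open>Members of \<open>S\<close> are strictly positive, so the bound
    \<open>y 0 / lam\<close> itself fails to belong to \<open>S\<close> when the initial datum is
    already constant; adding \<open>e\<close> avoids this case.\<close>
  proof (rule field_le_epsilon)
    fix e :: real assume e: "e > 0"
    define T where "T = y 0 / lam + e"
    have "T > 0" using y0[of 0] lam e by (simp add: T_def add_nonneg_pos)
    moreover have "AE x in \<nu>1. u t x = C" if "t \<ge> T" for t
    proof -
      have "y 0 / lam \<le> t" using that e by (simp add: T_def)
      then have "y 0 - lam * t \<le> 0" using lam by (simp add: field_simps)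
      then have "y t = 0" using main[of t] y0[of t] \<open>T > 0\<close> that by simp
      then have "AE x in \<nu>1. u t x - C = 0"
        using uC[of t] \<open>T > 0\<close> that by (intro L2norm_zero_AE) (auto simp: y_def)
      then show ?thesis by simp
    qed
    ultimately have "T \<in> S" by (simp add: S_def)
    moreover have "bdd_below S" by (auto simp: S_def intro!: bdd_belowI[of _ 0])
    ultimately show "Inf S \<le> y 0 / lam + e"
      unfolding T_def[symmetric] by (rule cInf_lower)
  qed
  with main show ?thesis unfolding S_def y_init unfolding y_def C_def by auto
qed

end
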